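(* Let $F$ be Thompson's group with standard generators $x_0,x_1$. Let $(G_n)_{n<\omega}$ be a convergent sequence of marked groups, where $G_n=(F,(g_n,x_0,x_1))$, $g_n\in F$ for $n<\omega$, and let $(G,(g,x_0,x_1))$ be its limit. Then $G$ is not an HNN-extension of $F$ of the form $F\ast_\alpha=\langle F,g\mid ghg^{-1}=\alpha(h),\ h\in H\rangle$, where $H$ is some finitely generated subgroup of $F$ and $\alpha$ is some embedding of $H$ into $F$ (here $F$ is the subgroup $\langle x_0,x_1\rangle$ of $G$ and the stable letter is the marking element $g$).
   Context: Thompson's group $F$ is the group, under composition, of all strictly increasing continuous piecewise-linear functions from $[0,1]$ onto itself which are differentiable except at finitely many dyadic rationals and all of whose slopes are integer powers of $2$. It is generated by $x_0,x_1$, where $x_0(t)=t/2$ on $[0,\frac12]$, $t-\frac14$ on $[\frac12,\frac34]$, $2t-1$ on $[\frac34,1]$; and $x_1(t)=t$ on $[0,\frac12]$, $\frac t2+\frac14$ on $[\frac12,\frac34]$, $t-\frac18$ on $[\frac34,\frac78]$, $2t-1$ on $[\frac78,1]$. A marked group $(G,S)$ is a group $G$ with a finite ordered tuple of generators $S=(s_1,\ldots,s_m)$. On the set $\mathcal{G}_m$ of groups marked by $m$ generators (up to isomorphism of marked groups) two marked groups are at distance at most $e^{-R}$ if they have exactly the same relations of length at most $R$. Convergence and limits are with respect to this metric. In the limit $(G,(g,x_0,x_1))$ the elements $x_0,x_1$ are the limits of the constant sequences $x_0$, $x_1$ and generate a copy of $F$; $g$ is the limit of $(g_n)_{n<\omega}$.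 *)

theory Defs
  imports "HOL-Analysis.Analysis" "HOL-Algebra.Generated_Groups" "HOL-Algebra.Bij"
begin

section \<open>Thompson's group F\<close>

definition piecewise_linear_on :: "real set \<Rightarrow> (real \<Rightarrow> real) \<Rightarrow> bool" where
  "piecewise_linear_on I f \<longleftrightarrow>
     (\<exists>P. finite P \<and>
        (\<forall>a b. a < b \<and> {a..b} \<subseteq> I \<and> {a<..<b} \<inter> P = {} \<longrightarrow>
           (\<exists>m c. \<forall>t\<in>{a..b}. f t = m * t + c)))"

text \<open>
  The library constant \<^const>\<open>dyadics\<close> only contains the nonnegative dyadic rationals, which
  is enough for points of \<open>[0,1]\<close>.  At \<open>0\<close> and \<open>1\<close> the derivative is one-sided.  As required by
  \<^const>\<open>BijGroup\<close>, functions on \<open>[0,1]\<close> are represented extensionally.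
\<close>
definition thompson_F_set :: "(real \<Rightarrow> real) set" where
  "thompson_F_set =
     {f \<in> extensional {0..1}.
        f ` {0..1} = {0..1} \<and> strict_mono_on {0..1} f \<and> continuous_on {0..1} f \<and>
        piecewise_linear_on {0..1} f \<and>
        (\<exists>D. finite D \<and> D \<subseteq> dyadics \<and>
           (\<forall>t\<in>{0..1} - D. \<exists>k::int. (f has_real_derivative 2 powi k) (at t within {0..1})))}"

text \<open>The product of \<open>f\<close> and \<open>g\<close> is the function \<open>t \<mapsto> f (g t)\<close>.\<close>
definition thompson_F :: "(real \<Rightarrow> real) monoid" where
  "thompson_F = (BijGroup {0..1})\<lparr>carrier := thompson_F_set\<rparr>"

definition thompson_x0 :: "real \<Rightarrow> real" where
  "thompson_x0 = (\<lambda>t\<in>{0..1}.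
     if t \<le> 1/2 then t / 2 else if t \<le> 3/4 then t - 1/4 else 2 * t - 1)"

definition thompson_x1 :: "real \<Rightarrow> real" where
  "thompson_x1 = (\<lambda>t\<in>{0..1}.
     if t \<le> 1/2 then t else if t \<le> 3/4 then t / 2 + 1/4
     else if t \<le> 7/8 then t - 1/8 else 2 * t - 1)"


section \<open>Marked groups\<close>

definition marked_group :: "('a, 'b) monoid_scheme \<Rightarrow> 'a list \<Rightarrow> bool" where
  "marked_group G S \<longleftrightarrow> group G \<and> set S \<subseteq> carrier G \<and> generate G (set S) = carrier G"

text \<open>
  A word in \<open>m\<close> generators and their inverses is a list of letters \<open>(i, e)\<close> with \<open>i < m\<close>; the
  letter \<open>(i, True)\<close> stands for the \<open>i\<close>-th generator and \<open>(i, False)\<close> for its inverse.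
\<close>
definition eval_letter :: "('a, 'b) monoid_scheme \<Rightarrow> 'a list \<Rightarrow> nat \<times> bool \<Rightarrow> 'a" where
  "eval_letter G S l = (if snd l then S ! fst l else inv\<^bsub>G\<^esub> (S ! fst l))"

definition eval_word :: "('a, 'b) monoid_scheme \<Rightarrow> 'a list \<Rightarrow> (nat \<times> bool) list \<Rightarrow> 'a" where
  "eval_word G S w = foldr (\<lambda>l a. eval_letter G S l \<otimes>\<^bsub>G\<^esub> a) w \<one>\<^bsub>G\<^esub>"

definition relations_upto ::
    "('a, 'b) monoid_scheme \<Rightarrow> 'a list \<Rightarrow> nat \<Rightarrow> (nat \<times> bool) list set" where
  "relations_upto G S R =
     {w. length w \<le> R \<and> fst ` set w \<subseteq> {..<length S} \<and> eval_word G S w = \<one>\<^bsub>G\<^esub>}"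

text \<open>
  Meant for markings of the same length.  The set below always contains \<open>exp 0\<close>, since the
  empty word is a relation of every marked group.  Marked groups that are isomorphic have
  distance \<open>0\<close>, so convergence may be expressed with representatives.
\<close>
definition marked_dist ::
    "('a, 'b) monoid_scheme \<times> 'a list \<Rightarrow> ('c, 'd) monoid_scheme \<times> 'c list \<Rightarrow> real" where
  "marked_dist = (\<lambda>(G, S) (K, T).
     Inf {exp (- real R) |R. relations_upto G S R = relations_upto K T R})"

lemma relations_upto_eq_mono:
  assumes "relations_upto G S R = relations_upto K T R" "Q \<le> R" "length S = length T"
  shows "relations_upto G S Q = relations_upto K T Q"
proof -
  have "relations_upto G S Q = relations_upto G S R \<inter> {w. length w \<le> Q}"
       "relations_upto K T Q = relations_upto K T R \<inter> {w. length w \<le> Q}"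
    using assms(2) by (auto simp: relations_upto_def)
  then show ?thesis using assms(1) by simp
qed

lemma marked_dist_le_iff:
  assumes "length S = length T"
  shows "marked_dist (G, S) (K, T) \<le> exp (- real R) \<longleftrightarrow>
         relations_upto G S R = relations_upto K T R"
proof
  let ?X = "{exp (- real R) |R. relations_upto G S R = relations_upto K T R}"
  have bdd: "bdd_below ?X"
    by (rule bdd_belowI[where m = 0]) auto
  {
    assume "relations_upto G S R = relations_upto K T R"
    then show "marked_dist (G, S) (K, T) \<le> exp (- real R)"
      unfolding marked_dist_def by (auto intro!: cInf_lower bdd)
  next
    assume le: "marked_dist (G, S) (K, T) \<le> exp (- real R)"
    have "relations_upto G S 0 = relations_upto K T 0"
      by (auto simp: relations_upto_def eval_word_def)
    then have ne: "?X \<noteq> {}" by blast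
    have "Inf ?X < exp (- (real R - 1/2))"
      using le unfolding marked_dist_def
      by (simp add: order.strict_trans1[of _ "exp (- real R)"])
    then obtain y where "y \<in> ?X" "y < exp (- (real R - 1/2))"
      using cInf_lessD[OF ne] by blast
    then obtain Q where Q: "relations_upto G S Q = relations_upto K T Q"
        "exp (- real Q) < exp (- (real R - 1/2))"
      by blast
    then have "R \<le> Q" by simp
    with Q(1) show "relations_upto G S R = relations_upto K T R"
      using assms relations_upto_eq_mono by blast
  }
qed


section \<open>HNN extensions\<close>

definition finitely_generated_subgroup :: "'a set \<Rightarrow> ('a, 'b) monoid_scheme \<Rightarrow> bool" where
  "finitely_generated_subgroup H G \<longleftrightarrow>
     subgroup H G \<and> (\<exists>S. finite S \<and> S \<subseteq> H \<and> generate G S = H)"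

datatype 'a hnn_letter = Base 'a | Stable | StableInv

definition hnn_words :: "('a, 'b) monoid_scheme \<Rightarrow> 'a hnn_letter list set" where
  "hnn_words A = lists (Base ` carrier A \<union> {Stable, StableInv})"

text \<open>
  The presentation \<open>\<langle>A, t | t h t\<inverse> = \<alpha> h, h \<in> H\<rangle>\<close>, written as a monoid presentation: the
  generators are the elements of \<open>A\<close> together with \<open>t\<close> and \<open>t\<inverse>\<close>, and the first two rules below
  are the multiplication table of \<open>A\<close>.
\<close>
inductive_set hnn_relators ::
    "('a, 'b) monoid_scheme \<Rightarrow> 'a set \<Rightarrow> ('a \<Rightarrow> 'a) \<Rightarrow> ('a hnn_letter list \<times> 'a hnn_letter list) set"
  for A :: "('a, 'b) monoid_scheme" and H :: "'a set" and \<alpha> :: "'a \<Rightarrow> 'a" where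
  base_one: "([Base \<one>\<^bsub>A\<^esub>], []) \<in> hnn_relators A H \<alpha>"
| base_mult: "a \<in> carrier A \<Longrightarrow> b \<in> carrier A \<Longrightarrow>
    ([Base a, Base b], [Base (a \<otimes>\<^bsub>A\<^esub> b)]) \<in> hnn_relators A H \<alpha>"
| stable_inv: "([Stable, StableInv], []) \<in> hnn_relators A H \<alpha>"
| inv_stable: "([StableInv, Stable], []) \<in> hnn_relators A H \<alpha>"
| conjugation: "h \<in> H \<Longrightarrow>
    ([Stable, Base h, StableInv], [Base (\<alpha> h)]) \<in> hnn_relators A H \<alpha>"

inductive_set hnn_congruence ::
    "('a, 'b) monoid_scheme \<Rightarrow> 'a set \<Rightarrow> ('a \<Rightarrow> 'a) \<Rightarrow> ('a hnn_letter list \<times> 'a hnn_letter list) set"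
  for A :: "('a, 'b) monoid_scheme" and H :: "'a set" and \<alpha> :: "'a \<Rightarrow> 'a" where
  refl: "u \<in> hnn_words A \<Longrightarrow> (u, u) \<in> hnn_congruence A H \<alpha>"
| sym: "(u, v) \<in> hnn_congruence A H \<alpha> \<Longrightarrow> (v, u) \<in> hnn_congruence A H \<alpha>"
| trans: "(u, v) \<in> hnn_congruence A H \<alpha> \<Longrightarrow> (v, w) \<in> hnn_congruence A H \<alpha> \<Longrightarrow>
    (u, w) \<in> hnn_congruence A H \<alpha>"
| relator: "(r, s) \<in> hnn_relators A H \<alpha> \<Longrightarrow> p \<in> hnn_words A \<Longrightarrow> q \<in> hnn_words A \<Longrightarrow>
    (p @ r @ q, p @ s @ q) \<in> hnn_congruence A H \<alpha>"

definition hnn_class ::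
    "('a, 'b) monoid_scheme \<Rightarrow> 'a set \<Rightarrow> ('a \<Rightarrow> 'a) \<Rightarrow> 'a hnn_letter list \<Rightarrow> 'a hnn_letter list set" where
  "hnn_class A H \<alpha> w = hnn_congruence A H \<alpha> `` {w}"

definition hnn_group ::
    "('a, 'b) monoid_scheme \<Rightarrow> 'a set \<Rightarrow> ('a \<Rightarrow> 'a) \<Rightarrow> 'a hnn_letter list set monoid" where
  "hnn_group A H \<alpha> =
     \<lparr>carrier = hnn_words A // hnn_congruence A H \<alpha>,
      mult = (\<lambda>U V. hnn_congruence A H \<alpha> `` {u @ v |u v. u \<in> U \<and> v \<in> V}),
      one = hnn_class A H \<alpha> []\<rparr>"

text \<open>
  The group \<open>G\<close> is the HNN extension of its subgroup \<open>A\<close> with associated subgroup \<open>H\<close>, embedding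
  \<open>\<alpha>\<close> and stable letter \<open>t\<close>: the inclusion of \<open>A\<close> and the element \<open>t\<close> of \<open>G\<close> induce an isomorphism
  from the presented group onto \<open>G\<close>.
\<close>
definition is_hnn_extension ::
    "('a, 'b) monoid_scheme \<Rightarrow> 'a set \<Rightarrow> 'a set \<Rightarrow> ('a \<Rightarrow> 'a) \<Rightarrow> 'a \<Rightarrow> bool" where
  "is_hnn_extension G A H \<alpha> t \<longleftrightarrow>
     subgroup A G \<and> t \<in> carrier G \<and>
     subgroup H (G\<lparr>carrier := A\<rparr>) \<and> \<alpha> \<in> mon (G\<lparr>carrier := H\<rparr>) (G\<lparr>carrier := A\<rparr>) \<and>
     (\<exists>\<phi> \<in> iso (hnn_group (G\<lparr>carrier := A\<rparr>) H \<alpha>) G.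
        (\<forall>a\<in>A. \<phi> (hnn_class (G\<lparr>carrier := A\<rparr>) H \<alpha> [Base a]) = a) \<and>
        \<phi> (hnn_class (G\<lparr>carrier := A\<rparr>) H \<alpha> [Stable]) = t)"

end

theory Submission
  imports Defs
begin

text \<open>
  Suppose \<open>G\<close> is such an HNN extension. As \<open>H\<close> is finitely generated, \<open>g\<^sub>n h g\<^sub>n\<inverse> = \<alpha> h\<close> holds in
  \<open>F\<close> for all \<open>h \<in> H\<close> and all large \<open>n\<close>, so \<open>\<alpha>\<close> is the conjugation by some \<open>c = g\<^sub>N\<close> and
  \<open>d\<^sub>n = c\<inverse>g\<^sub>n\<close> centralizes \<open>H\<close> for \<open>n \<ge> N\<close>. Put \<open>t = c\<inverse>g\<close>, the limit of the \<open>d\<^sub>n\<close>; here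
  \<open>c \<in> \<langle>x\<^sub>0, x\<^sub>1\<rangle>\<close> since \<open>x\<^sub>0, x\<^sub>1\<close> generate \<open>F\<close>.

  Let \<open>a\<close> be supported in \<open>[0,s]\<close> and \<open>b\<close> in \<open>[s,1]\<close>. If \<open>d\<^sub>n s \<ge> s\<close> then \<open>a\<close> commutes with
  \<open>d\<^sub>n b d\<^sub>n\<inverse>\<close>, and otherwise \<open>b\<close> commutes with \<open>d\<^sub>n a d\<^sub>n\<inverse>\<close>. One of the two cases occurs
  infinitely often, so \<open>[a, t b t\<inverse>] = 1\<close> or \<open>[b, t a t\<inverse>] = 1\<close> in \<open>G\<close>. In an HNN extension this
  forces \<open>a \<in> H\<close> or \<open>b \<in> H\<close>. Hence for every \<open>s\<close> the group \<open>H\<close> contains all elements supported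
  in \<open>[0,s]\<close> or all elements supported in \<open>[s,1]\<close>, which makes its centralizer trivial. So
  \<open>d\<^sub>n = 1\<close> for \<open>n \<ge> N\<close>, that is \<open>g = c\<close>, but the stable letter does not lie in the base.
\<close>

section \<open>Conjugation HNN extensions\<close>

lemma hnn_words_append: "u \<in> hnn_words A \<Longrightarrow> v \<in> hnn_words A \<Longrightarrow> u @ v \<in> hnn_words A"
  by (simp add: hnn_words_def)

lemma hnn_words_simps [simp]:
  "[] \<in> hnn_words A"
  "Base a # u \<in> hnn_words A \<longleftrightarrow> a \<in> carrier A \<and> u \<in> hnn_words A"
  "Stable # u \<in> hnn_words A \<longleftrightarrow> u \<in> hnn_words A"
  "StableInv # u \<in> hnn_words A \<longleftrightarrow> u \<in> hnn_words A"
  by (auto simp: hnn_words_def)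

lemma hnn_relators_words:
  assumes "group A" "H \<subseteq> carrier A" "\<alpha> ` H \<subseteq> carrier A" "(r, s) \<in> hnn_relators A H \<alpha>"
  shows "r \<in> hnn_words A" "s \<in> hnn_words A"
  using assms(4)
  by (induction) (use assms(1-3) in \<open>auto simp: monoid.m_closed[OF group.is_monoid]
      monoid.one_closed[OF group.is_monoid]\<close>)

lemma hnn_congruence_words:
  assumes "group A" "H \<subseteq> carrier A" "\<alpha> ` H \<subseteq> carrier A" "(u, v) \<in> hnn_congruence A H \<alpha>"
  shows "u \<in> hnn_words A \<and> v \<in> hnn_words A"
  using assms(4)
  by (induction) (auto simp: hnn_words_append hnn_relators_words[OF assms(1-3)])

text \<open>The rule \<open>relator\<close> carries arbitrary contexts \<open>p\<close> and
  \<open>q\<close>, so appending only enlarges a context; with the mirror lemma below, concatenation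
  respects the congruence.\<close>

lemma hnn_congruence_append_right:
  assumes "(u, v) \<in> hnn_congruence A H \<alpha>" "q \<in> hnn_words A"
  shows "(u @ q, v @ q) \<in> hnn_congruence A H \<alpha>"
  using assms
proof induction
  case (relator r s p q')
  then show ?case
    using hnn_congruence.relator[of r s A H \<alpha> p "q' @ q"] by (simp add: hnn_words_append)
qed (auto intro: hnn_congruence.intros hnn_words_append)

lemma hnn_congruence_append_left:
  assumes "(u, v) \<in> hnn_congruence A H \<alpha>" "p \<in> hnn_words A"
  shows "(p @ u, p @ v) \<in> hnn_congruence A H \<alpha>"
  using assms
proof induction
  case (relator r s p' q)
  then show ?case
    using hnn_congruence.relator[of r s A H \<alpha> "p @ p'" q] by (simp add: hnn_words_append)
qed (auto intro: hnn_congruence.intros hnn_words_append)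

lemma hnn_class_in_carrier: "u \<in> hnn_words A \<Longrightarrow> hnn_class A H \<alpha> u \<in> carrier (hnn_group A H \<alpha>)"
  by (auto simp: hnn_group_def hnn_class_def quotient_def)

lemma hnn_class_eq:
  assumes "(u, v) \<in> hnn_congruence A H \<alpha>"
  shows "hnn_class A H \<alpha> u = hnn_class A H \<alpha> v"
  using assms unfolding hnn_class_def by (auto intro: hnn_congruence.sym hnn_congruence.trans)

lemma hnn_class_eqD:
  assumes "hnn_class A H \<alpha> u = hnn_class A H \<alpha> v" "v \<in> hnn_words A"
  shows "(u, v) \<in> hnn_congruence A H \<alpha>"
  using assms hnn_congruence.refl[OF assms(2), of H \<alpha>] unfolding hnn_class_def by auto

text \<open>The product of two classes collects the concatenations of all representatives. By
  compatibility on both sides these are all congruent to \<open>u @ v\<close>, so the union is a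
  single class.\<close>

lemma hnn_class_mult:
  assumes "group A" "H \<subseteq> carrier A" "\<alpha> ` H \<subseteq> carrier A" "u \<in> hnn_words A" "v \<in> hnn_words A"
  shows "hnn_class A H \<alpha> u \<otimes>\<^bsub>hnn_group A H \<alpha>\<^esub> hnn_class A H \<alpha> v = hnn_class A H \<alpha> (u @ v)"
proof -
  have "(u @ v, u' @ v') \<in> hnn_congruence A H \<alpha>"
    if "(u, u') \<in> hnn_congruence A H \<alpha>" "(v, v') \<in> hnn_congruence A H \<alpha>" for u' v'
    using hnn_congruence_append_right[OF that(1) assms(5)]
      hnn_congruence_append_left[OF that(2), of u'] hnn_congruence_words[OF assms(1-3) that(1)]
    by (blast intro: hnn_congruence.trans)
  then show ?thesis
    using hnn_congruence.refl[OF assms(4)] hnn_congruence.refl[OF assms(5)]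
    by (auto simp: hnn_group_def hnn_class_def Image_def intro: hnn_congruence.trans) blast
qed

text \<open>
  For \<open>\<alpha>\<close> the conjugation by \<open>c\<close>, the extension acts on \<open>A \<times> \<int>\<close>: the base acts by left
  multiplication and \<open>c\<inverse>t\<close> raises the level of the points over \<open>H\<close>, which commutes with the
  action of \<open>H\<close>.
\<close>
fun hnn_act :: "('a, 'b) monoid_scheme \<Rightarrow> 'a set \<Rightarrow> 'a \<Rightarrow> 'a hnn_letter \<Rightarrow> 'a \<times> int \<Rightarrow> 'a \<times> int" where
  "hnn_act A H c (Base a) (x, i) = (a \<otimes>\<^bsub>A\<^esub> x, i)"
| "hnn_act A H c Stable (x, i) = (c \<otimes>\<^bsub>A\<^esub> x, if x \<in> H then i + 1 else i)"
| "hnn_act A H c StableInv (x, i) =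
     (inv\<^bsub>A\<^esub> c \<otimes>\<^bsub>A\<^esub> x, if inv\<^bsub>A\<^esub> c \<otimes>\<^bsub>A\<^esub> x \<in> H then i - 1 else i)"

lemma (in subgroup) mult_mem_iff:
  assumes "group G" "h \<in> H" "x \<in> carrier G"
  shows "h \<otimes> x \<in> H \<longleftrightarrow> x \<in> H"
proof -
  interpret group G by fact
  have h: "h \<in> carrier G" using assms(2) by (rule mem_carrier)
  show ?thesis
  proof
    assume "h \<otimes> x \<in> H"
    then have "inv h \<otimes> (h \<otimes> x) \<in> H" using assms(2)
      by (simp add: subgroup.m_closed[OF subgroup_axioms] subgroup.m_inv_closed[OF subgroup_axioms])
    then show "x \<in> H" using h assms(3) by (simp add: m_assoc[symmetric])
  qed (rule subgroup.m_closed[OF subgroup_axioms assms(2)])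
qed

context
  fixes A :: "('a, 'b) monoid_scheme" and H \<alpha> c
  assumes A: "group A" and H: "subgroup H A" and c: "c \<in> carrier A"
    and \<alpha>: "\<And>h. h \<in> H \<Longrightarrow> \<alpha> h = c \<otimes>\<^bsub>A\<^esub> h \<otimes>\<^bsub>A\<^esub> inv\<^bsub>A\<^esub> c"
begin

interpretation A: group A by (rule A)

lemma hnn_act_closed:
  assumes "w \<in> hnn_words A" "p \<in> carrier A \<times> UNIV"
  shows "foldr (hnn_act A H c) w p \<in> carrier A \<times> UNIV"
proof -
  have step: "hnn_act A H c l q \<in> carrier A \<times> UNIV"
    if "[l] \<in> hnn_words A" "q \<in> carrier A \<times> UNIV" for l q
    using that c by (cases q; cases l) auto
  show ?thesis using assms(1)
  proof (induction w)
    case (Cons l u)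
    then have "[l] \<in> hnn_words A" "u \<in> hnn_words A" by (cases l; simp)+
    then show ?case using step[of l] Cons.IH by simp
  qed (simp add: assms(2))
qed

lemma hnn_act_relator:
  assumes "(r, s) \<in> hnn_relators A H \<alpha>" "p \<in> carrier A \<times> UNIV"
  shows "foldr (hnn_act A H c) r p = foldr (hnn_act A H c) s p"
proof -
  obtain x i where p: "p = (x, i)" "x \<in> carrier A" using assms(2) by auto
  show ?thesis using assms(1)
  proof cases
    case (conjugation h)
    let ?y = "inv\<^bsub>A\<^esub> c \<otimes>\<^bsub>A\<^esub> x"
    \<comment> \<open>The letters act from right to left: \<open>StableInv\<close> lowers the level
      if \<open>?y \<in> H\<close>, and after multiplication by \<open>h\<close> the letter
      \<open>Stable\<close> raises it if \<open>h\<close> times \<open>?y\<close> is in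
      \<open>H\<close>. For \<open>h \<in> H\<close> the two tests agree, so the level is unchanged
      and only c h c^-1 = \<alpha> h remains.\<close>
    have "h \<in> carrier A" "h \<otimes>\<^bsub>A\<^esub> ?y \<in> H \<longleftrightarrow> ?y \<in> H"
      using conjugation p c subgroup.mult_mem_iff[OF H A] subgroup.subset[OF H] by auto
    then show ?thesis using p c conjugation by (auto simp: \<alpha> A.m_assoc)
  next
    case (base_mult a b)
    then show ?thesis using p by (simp add: A.m_assoc)
  next
    case stable_inv
    then show ?thesis using p c by (simp add: A.m_assoc[symmetric])
  next
    case inv_stable
    then show ?thesis using p c by (simp add: A.m_assoc[symmetric])
  qed (use p in simp)
qed

text \<open>The action thus descends to the presented group: two words are shown to be different
  there by applying them to one point.\<close>

lemma hnn_act_congruence: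
  assumes "(u, v) \<in> hnn_congruence A H \<alpha>" "p \<in> carrier A \<times> UNIV"
  shows "foldr (hnn_act A H c) u p = foldr (hnn_act A H c) v p"
  using assms(1)
proof induction
  case (relator r s u v)
  then show ?case using hnn_act_relator[OF relator(1) hnn_act_closed[OF relator(3) assms(2)]] by simp
qed auto

end

text \<open>Here \<open>\<rho>\<close> evaluates words in \<open>G\<close>: it is the class map
  followed by the given isomorphism. The last property translates an equation in \<open>G\<close>
  into a congruence of words, to which the action applies.\<close>

lemma is_hnn_extensionE:
  assumes "group G" "is_hnn_extension G A H \<alpha> t"
  obtains \<rho> where
    "\<And>a. a \<in> A \<Longrightarrow> \<rho> [Base a] = a" "\<rho> [Stable] = t" "\<rho> [StableInv] = inv\<^bsub>G\<^esub> t"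
    "\<And>u v. u \<in> hnn_words (G\<lparr>carrier := A\<rparr>) \<Longrightarrow> v \<in> hnn_words (G\<lparr>carrier := A\<rparr>) \<Longrightarrow>
       \<rho> (u @ v) = \<rho> u \<otimes>\<^bsub>G\<^esub> \<rho> v"
    "\<And>u v. u \<in> hnn_words (G\<lparr>carrier := A\<rparr>) \<Longrightarrow> v \<in> hnn_words (G\<lparr>carrier := A\<rparr>) \<Longrightarrow>
       \<rho> u = \<rho> v \<longleftrightarrow> (u, v) \<in> hnn_congruence (G\<lparr>carrier := A\<rparr>) H \<alpha>"
proof -
  let ?A = "G\<lparr>carrier := A\<rparr>"
  have sub: "subgroup A G" "subgroup H ?A" "\<alpha> \<in> mon (G\<lparr>carrier := H\<rparr>) ?A" "t \<in> carrier G"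
    using assms by (auto simp: is_hnn_extension_def)
  interpret G: group G by fact
  have A: "group ?A" using G.subgroup_imp_group sub by auto
  have H: "H \<subseteq> carrier ?A" "\<alpha> ` H \<subseteq> carrier ?A"
    using subgroup.subset[OF sub(2)] sub(3) by (auto simp: mon_def hom_def)
  obtain \<phi> where \<phi>: "\<phi> \<in> iso (hnn_group ?A H \<alpha>) G"
    "\<And>a. a \<in> A \<Longrightarrow> \<phi> (hnn_class ?A H \<alpha> [Base a]) = a" "\<phi> (hnn_class ?A H \<alpha> [Stable]) = t"
    using assms by (auto simp: is_hnn_extension_def)
  define \<rho> where "\<rho> = (\<lambda>w. \<phi> (hnn_class ?A H \<alpha> w))"
  have mult: "\<rho> (u @ v) = \<rho> u \<otimes>\<^bsub>G\<^esub> \<rho> v" if "u \<in> hnn_words ?A" "v \<in> hnn_words ?A" for u v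
    unfolding \<rho>_def
    using \<phi>(1) that hnn_class_mult[OF A H that] hnn_class_in_carrier[of u ?A H \<alpha>] 
      hnn_class_in_carrier[of v ?A H \<alpha>]
    by (metis hom_mult iso_imp_homomorphism)
  have cl: "\<rho> u \<in> carrier G" if "u \<in> hnn_words ?A" for u
    using \<phi>(1) hnn_class_in_carrier[OF that, of H \<alpha>]
    by (auto simp: \<rho>_def iso_def hom_def)
  have inj: "\<rho> u = \<rho> v \<longleftrightarrow> (u, v) \<in> hnn_congruence ?A H \<alpha>"
    if "u \<in> hnn_words ?A" "v \<in> hnn_words ?A" for u v
  proof
    assume "\<rho> u = \<rho> v"
    moreover have "inj_on \<phi> (carrier (hnn_group ?A H \<alpha>))"
      using \<phi>(1) by (simp add: iso_def bij_betw_def)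
    ultimately have "hnn_class ?A H \<alpha> u = hnn_class ?A H \<alpha> v"
      unfolding \<rho>_def using that hnn_class_in_carrier by (metis inj_onD)
    then show "(u, v) \<in> hnn_congruence ?A H \<alpha>" using that hnn_class_eqD by blast
  qed (simp add: \<rho>_def hnn_class_eq)
  have "\<rho> [] = \<rho> [] \<otimes>\<^bsub>G\<^esub> \<rho> []" using mult[of "[]" "[]"] by simp
  then have one: "\<rho> [] = \<one>\<^bsub>G\<^esub>" using cl[of "[]"] by simp
  have "([] @ [StableInv, Stable] @ [], [] @ [] @ []) \<in> hnn_congruence ?A H \<alpha>"
    by (rule hnn_congruence.relator[OF hnn_relators.inv_stable]) auto
  then have "\<rho> ([StableInv] @ [Stable]) = \<one>\<^bsub>G\<^esub>" using one by (simp add: \<rho>_def hnn_class_eq)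
  then have "\<rho> [StableInv] \<otimes>\<^bsub>G\<^esub> t = \<one>\<^bsub>G\<^esub>" using \<phi>(3) by (subst (asm) mult) (auto simp: \<rho>_def)
  then have "\<rho> [StableInv] = inv\<^bsub>G\<^esub> t" using cl[of "[StableInv]"] sub(4) G.inv_equality by simp
  then show ?thesis using that[of \<rho>] \<phi> mult inj by (simp add: \<rho>_def)
qed

lemma hnn_extension_conjugation:
  assumes "group G" "is_hnn_extension G A H \<alpha> t" "h \<in> H"
  shows "t \<otimes>\<^bsub>G\<^esub> h \<otimes>\<^bsub>G\<^esub> inv\<^bsub>G\<^esub> t = \<alpha> h"
proof -
  let ?A = "G\<lparr>carrier := A\<rparr>"
  interpret G: group G by fact
  have t: "t \<in> carrier G" and A: "subgroup A G" and hA: "h \<in> A" and ah: "\<alpha> h \<in> A"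
    using assms subgroup.subset[of H ?A] by (auto simp: is_hnn_extension_def mon_def hom_def)
  have h: "h \<in> carrier G" using hA subgroup.mem_carrier[OF A] by simp
  obtain \<rho> where \<rho>: "\<And>a. a \<in> A \<Longrightarrow> \<rho> [Base a] = a" "\<rho> [Stable] = t" "\<rho> [StableInv] = inv\<^bsub>G\<^esub> t"
    "\<And>u v. u \<in> hnn_words ?A \<Longrightarrow> v \<in> hnn_words ?A \<Longrightarrow> \<rho> (u @ v) = \<rho> u \<otimes>\<^bsub>G\<^esub> \<rho> v"
    "\<And>u v. u \<in> hnn_words ?A \<Longrightarrow> v \<in> hnn_words ?A \<Longrightarrow>
       \<rho> u = \<rho> v \<longleftrightarrow> (u, v) \<in> hnn_congruence ?A H \<alpha>"
    using is_hnn_extensionE[OF assms(1,2)] by blast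
  have "([] @ [Stable, Base h, StableInv] @ [], [] @ [Base (\<alpha> h)] @ []) \<in> hnn_congruence ?A H \<alpha>"
    by (rule hnn_congruence.relator[OF hnn_relators.conjugation]) (use assms in auto)
  then have "\<rho> ([Stable] @ [Base h] @ [StableInv]) = \<rho> [Base (\<alpha> h)]"
    using \<rho>(5) hA ah by simp
  moreover have "\<rho> ([Stable] @ [Base h] @ [StableInv]) = \<rho> [Stable] \<otimes>\<^bsub>G\<^esub> (\<rho> [Base h] \<otimes>\<^bsub>G\<^esub> \<rho> [StableInv])"
    using \<rho>(4)[of "[Stable]" "[Base h] @ [StableInv]"] \<rho>(4)[of "[Base h]" "[StableInv]"] hA by simp
  ultimately show ?thesis
    using hA ah t h by (simp add: \<rho>(1-3) G.m_assoc)
qed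

section \<open>Elements of a conjugation extension told apart by the action\<close>

context
  fixes G :: "('a, 'b) monoid_scheme" and A H \<alpha> t c
  assumes G: "group G" and hnn: "is_hnn_extension G A H \<alpha> t" and c: "c \<in> A"
    and \<alpha>: "\<And>h. h \<in> H \<Longrightarrow> \<alpha> h = c \<otimes>\<^bsub>G\<^esub> h \<otimes>\<^bsub>G\<^esub> inv\<^bsub>G\<^esub> c"
begin

lemma hnn_extension_act:
  assumes "u \<in> hnn_words (G\<lparr>carrier := A\<rparr>)" "v \<in> hnn_words (G\<lparr>carrier := A\<rparr>)"
    "(u, v) \<in> hnn_congruence (G\<lparr>carrier := A\<rparr>) H \<alpha>" "x \<in> A"
  shows "foldr (hnn_act (G\<lparr>carrier := A\<rparr>) H c) u (x, i) = foldr (hnn_act (G\<lparr>carrier := A\<rparr>) H c) v (x, i)"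
proof (rule hnn_act_congruence[OF _ _ _ _ assms(3)])
  have A: "subgroup A G" "subgroup H (G\<lparr>carrier := A\<rparr>)" using hnn by (auto simp: is_hnn_extension_def)
  then show "group (G\<lparr>carrier := A\<rparr>)" "subgroup H (G\<lparr>carrier := A\<rparr>)"
    using group.subgroup_imp_group[OF G] by auto
  show "\<alpha> h = c \<otimes>\<^bsub>G\<lparr>carrier := A\<rparr>\<^esub> h \<otimes>\<^bsub>G\<lparr>carrier := A\<rparr>\<^esub> inv\<^bsub>G\<lparr>carrier := A\<rparr>\<^esub> c" if "h \<in> H" for h
    using \<alpha>[OF that] group.m_inv_consistent[OF G A(1) c] by simp
qed (use c assms in auto)

text \<open>At the point (1, 0) the stable letter raises the level, because 1 lies in
  \<open>H\<close>, whereas a base letter never changes the level.\<close>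

lemma stable_letter_notin_base: "t \<notin> A"
proof
  assume t: "t \<in> A"
  let ?A = "G\<lparr>carrier := A\<rparr>"
  have A: "subgroup A G" "subgroup H ?A" using hnn by (auto simp: is_hnn_extension_def)
  interpret A: group ?A using group.subgroup_imp_group[OF G A(1)] .
  obtain \<rho> where \<rho>: "\<And>a. a \<in> A \<Longrightarrow> \<rho> [Base a] = a" "\<rho> [Stable] = t"
    "\<And>u v. u \<in> hnn_words ?A \<Longrightarrow> v \<in> hnn_words ?A \<Longrightarrow>
       \<rho> u = \<rho> v \<longleftrightarrow> (u, v) \<in> hnn_congruence ?A H \<alpha>"
    using is_hnn_extensionE[OF G hnn] by blast
  have "\<rho> [Stable] = \<rho> [Base t]" using \<rho> t by simp
  then have "([Stable], [Base t]) \<in> hnn_congruence ?A H \<alpha>" using t by (subst (asm) \<rho>(3)) auto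
  then show False
    using hnn_extension_act[of "[Stable]" "[Base t]" "\<one>\<^bsub>?A\<^esub>" 0] t A.one_closed subgroup.one_closed[OF A(2)]
    by simp
qed

text \<open>
  Acting on the point \<open>(\<one>, 0)\<close>, the product \<open>a s b s\<inverse>\<close> lowers the level, while
  \<open>s b s\<inverse> a\<close> does not.
\<close>
lemma commuting_conjugate_in_associated:
  fixes s
  defines "s \<equiv> inv\<^bsub>G\<^esub> c \<otimes>\<^bsub>G\<^esub> t"
  assumes a: "a \<in> A" and b: "b \<in> A"
    and comm: "a \<otimes>\<^bsub>G\<^esub> (s \<otimes>\<^bsub>G\<^esub> b \<otimes>\<^bsub>G\<^esub> inv\<^bsub>G\<^esub> s) = s \<otimes>\<^bsub>G\<^esub> b \<otimes>\<^bsub>G\<^esub> inv\<^bsub>G\<^esub> s \<otimes>\<^bsub>G\<^esub> a"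
  shows "a \<in> H \<or> b \<in> H"
proof (rule ccontr)
  assume notH: "\<not> (a \<in> H \<or> b \<in> H)"
  let ?A = "G\<lparr>carrier := A\<rparr>"
  interpret G: group G by (rule G)
  have A: "subgroup A G" "subgroup H ?A" and t: "t \<in> carrier G"
    using hnn by (auto simp: is_hnn_extension_def)
  interpret A: group ?A using group.subgroup_imp_group[OF G A(1)] .
  note carr = subgroup.mem_carrier[OF A(1)]
  have ic: "inv\<^bsub>G\<^esub> c \<in> A" using subgroup.m_inv_closed[OF A(1) c] .
  have icc: "inv\<^bsub>?A\<^esub> c = inv\<^bsub>G\<^esub> c" using G.m_inv_consistent[OF A(1) c] .
  obtain \<rho> where \<rho>: "\<And>a. a \<in> A \<Longrightarrow> \<rho> [Base a] = a" "\<rho> [Stable] = t" "\<rho> [StableInv] = inv\<^bsub>G\<^esub> t"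
    "\<And>u v. u \<in> hnn_words ?A \<Longrightarrow> v \<in> hnn_words ?A \<Longrightarrow> \<rho> (u @ v) = \<rho> u \<otimes>\<^bsub>G\<^esub> \<rho> v"
    "\<And>u v. u \<in> hnn_words ?A \<Longrightarrow> v \<in> hnn_words ?A \<Longrightarrow>
       \<rho> u = \<rho> v \<longleftrightarrow> (u, v) \<in> hnn_congruence ?A H \<alpha>"
    using is_hnn_extensionE[OF G hnn] by blast
  have cons: "\<rho> (l # l' # u) = \<rho> [l] \<otimes>\<^bsub>G\<^esub> \<rho> (l' # u)"
    if "[l] \<in> hnn_words ?A" "l' # u \<in> hnn_words ?A" for l l' u
    using \<rho>(4)[OF that] by simp
  \<comment> \<open>With s = c^-1 t the conjugate s b s^-1 is c^-1 t b t^-1 c, spelled out letter by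
    letter.\<close>
  let ?k = "[Base (inv\<^bsub>G\<^esub> c), Stable, Base b, StableInv, Base c]"
  have k: "?k \<in> hnn_words ?A" using ic c b by simp
  have "\<rho> ?k = s \<otimes>\<^bsub>G\<^esub> b \<otimes>\<^bsub>G\<^esub> inv\<^bsub>G\<^esub> s"
    using ic c b t carr by (simp add: cons \<rho>(1-3) s_def G.m_assoc G.inv_mult_group)
  then have "\<rho> ([Base a] @ ?k) = \<rho> (?k @ [Base a])"
    using comm k a by (simp add: \<rho>(1,4) del: append.simps)
  then have "([Base a] @ ?k, ?k @ [Base a]) \<in> hnn_congruence ?A H \<alpha>"
    using k a ic c b by (subst (asm) \<rho>(5)) (auto simp: hnn_words_append)
  moreover define K where "K = foldr (hnn_act ?A H c) ?k"
  ultimately have act: "hnn_act ?A H c (Base a) (K (\<one>\<^bsub>G\<^esub>, 0)) = K (hnn_act ?A H c (Base a) (\<one>\<^bsub>G\<^esub>, 0))"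
    using hnn_extension_act[of "[Base a] @ ?k" "?k @ [Base a]" "\<one>\<^bsub>G\<^esub>" 0] k a ic c b
      subgroup.one_closed[OF A(1)]
    unfolding foldr_append by (simp add: hnn_words_append K_def del: hnn_act.simps)
  have cc: "inv\<^bsub>G\<^esub> c \<otimes>\<^bsub>G\<^esub> (c \<otimes>\<^bsub>G\<^esub> x) = x" if "x \<in> A" for x
    using that carr c by (simp add: G.m_assoc[symmetric])
  \<comment> \<open>\<open>Base c\<close> followed by \<open>StableInv\<close> returns to
    \<open>x\<close> and tests \<open>x\<close>; after \<open>Base b\<close> the letter
    \<open>Stable\<close> tests \<open>b\<close> times \<open>x\<close>, and the last letter cancels
    its factor \<open>c\<close>.\<close>
  have level: "K (x, i) = (b \<otimes>\<^bsub>G\<^esub> x,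
      (if x \<in> H then i - 1 else i) + (if b \<otimes>\<^bsub>G\<^esub> x \<in> H then 1 else 0))" if "x \<in> A" for x i
    using that b by (simp add: K_def icc cc subgroup.m_closed[OF A(1)])
  \<comment> \<open>Comparison of levels: at 1 the level drops to -1 and \<open>b \<notin> H\<close>
    keeps it from being restored, while at \<open>a\<close> it cannot drop because
    \<open>a \<notin> H\<close>.\<close>
  show False
    using act notH subgroup.one_closed[OF A(1)] subgroup.one_closed[OF A(2)] a b carr
    by (simp add: level split: if_splits)
qed

end

section \<open>Dyadic cells\<close>

text \<open>\<open>f\<close> maps the dyadic cell [j/2^m, (j+1)/2^m] affinely and increasingly onto
  [j'/2^m', (j'+1)/2^m']. With the relative position \<open>s\<close> as common coordinate,
  composition is chaining of cells and inversion is exchange of the two cells.\<close>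

definition canon :: "(real \<Rightarrow> real) \<Rightarrow> nat \<Rightarrow> nat \<Rightarrow> nat \<Rightarrow> nat \<Rightarrow> bool" where
  "canon f m j m' j' \<longleftrightarrow> (\<forall>s\<in>{0..1}. f ((real j + s) / 2 ^ m) = (real j' + s) / 2 ^ m')"

text \<open>Only the source cells share a level; the target levels vary with the slopes. This is the
  combinatorial substitute for the conditions on derivatives in F.\<close>

definition dyadic_grid_map :: "(real \<Rightarrow> real) \<Rightarrow> nat \<Rightarrow> bool" where
  "dyadic_grid_map f M \<longleftrightarrow> (\<forall>j<2 ^ M. \<exists>m' j'. canon f M j m' j')"

lemma canonD: "canon f m j m' j' \<Longrightarrow> 0 \<le> s \<Longrightarrow> s \<le> 1 \<Longrightarrow> f ((real j + s) / 2 ^ m) = (real j' + s) / 2 ^ m'"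
  by (simp add: canon_def)

lemma cell_in_unit:
  assumes "j < 2 ^ m" "0 \<le> s" "s \<le> 1"
  shows "(real j + s) / 2 ^ m \<in> {0..1}"
proof -
  have "real (j + 1) \<le> real (2 ^ m)" using assms(1) by (intro of_nat_mono) simp
  then show ?thesis using assms by simp
qed

lemma dyadic_cell_cases:
  fixes t :: real
  assumes "t \<in> {0..<1}"
  obtains j s where "j < 2 ^ m" "0 \<le> s" "s < 1" "t = (real j + s) / 2 ^ m"
proof
  let ?j = "nat \<lfloor>2 ^ m * t\<rfloor>"
  have j: "real ?j = \<lfloor>2 ^ m * t\<rfloor>" using assms by simp
  have "real ?j \<le> 2 ^ m * t" using j by simp
  also have "\<dots> < 2 ^ m * 1" using assms by (intro mult_strict_left_mono) auto
  finally have "real ?j < real (2 ^ m)" by simp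
  then show "?j < 2 ^ m" by (simp only: of_nat_less_iff)
  show "0 \<le> 2 ^ m * t - ?j" "2 ^ m * t - ?j < 1" using j by linarith+
qed simp

lemma dyadic_cell_cases':
  fixes t :: real
  assumes "t \<in> {0..1}"
  obtains j s where "j < 2 ^ m" "0 \<le> s" "s \<le> 1" "t = (real j + s) / 2 ^ m"
proof (cases "t = 1")
  case True
  \<comment> \<open>The point 1 is reached only as the right end of the last cell, which is why
    \<open>s = 1\<close> has to be allowed.\<close>
  then show ?thesis using that[of "2 ^ m - 1" 1] by (simp add: of_nat_diff)
next
  case False
  then show ?thesis using that assms dyadic_cell_cases[of t m] by (metis atLeastAtMost_iff atLeastLessThan_iff less_eq_real_def)
qed

text \<open>Source and target are both cut into 2^r equal pieces, and an increasing affine map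
  matches the pieces in order; hence the same offset \<open>u\<close> on both sides.\<close>

lemma canon_subcell:
  assumes "canon f m j m' j'" "u < 2 ^ r"
  shows "canon f (m + r) (2 ^ r * j + u) (m' + r) (2 ^ r * j' + u)"
  unfolding canon_def
proof
  fix s :: real assume s: "s \<in> {0..1}"
  have "real j + (u + s) / 2 ^ r = (2 ^ r * real j + u + s) / 2 ^ r"
    "real j' + (u + s) / 2 ^ r = (2 ^ r * real j' + u + s) / 2 ^ r"
    by (simp_all add: field_simps)
  then show "f ((real (2 ^ r * j + u) + s) / 2 ^ (m + r)) = (real (2 ^ r * j' + u) + s) / 2 ^ (m' + r)"
    using canonD[OF assms(1), of "(u + s) / 2 ^ r"] cell_in_unit[OF assms(2), of s] s
    by (simp add: power_add field_simps)
qed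

lemma div_less_power_add: "i < 2 ^ (M + r) \<Longrightarrow> i div 2 ^ r < (2::nat) ^ M"
  by (simp add: power_add less_mult_imp_div_less)

lemma dyadic_grid_map_refine:
  assumes "dyadic_grid_map f M" "M \<le> N"
  shows "dyadic_grid_map f N"
  unfolding dyadic_grid_map_def
proof (intro allI impI)
  fix i :: nat assume i: "i < 2 ^ N"
  define r where "r = N - M"
  have N: "N = M + r" using assms(2) by (simp add: r_def)
  have "i div 2 ^ r < 2 ^ M" using i N div_less_power_add by simp
  then obtain m' j' where "canon f M (i div 2 ^ r) m' j'"
    using assms(1) by (auto simp: dyadic_grid_map_def)
  from canon_subcell[OF this, of "i mod 2 ^ r" r] show "\<exists>m' j'. canon f N i m' j'"
    unfolding N by auto
qed

lemma canon_affine: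
  assumes "canon f m j m' j'" "t \<in> {real j / 2 ^ m..(real j + 1) / 2 ^ m}"
  shows "f t = (2 ^ m / 2 ^ m') * t + (real j' - real j) / 2 ^ m'"
proof -
  have "f ((real j + (2 ^ m * t - j)) / 2 ^ m) = (real j' + (2 ^ m * t - j)) / 2 ^ m'"
    by (rule canonD[OF assms(1)]) (use assms(2) in \<open>auto simp: field_simps\<close>)
  then show ?thesis by (simp add: add_divide_distrib diff_divide_distrib)
qed

lemma dyadics_common_denominator:
  assumes "finite D" "D \<subseteq> (dyadics :: real set)"
  shows "\<exists>M. \<forall>d\<in>D. \<exists>k::nat. d = real k / 2 ^ M"
  using assms
proof (induction rule: finite_induct)
  case (insert x D)
  then obtain M where M: "\<forall>d\<in>D. \<exists>k::nat. d = real k / 2 ^ M" by auto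
  obtain l m where x: "x = real l / 2 ^ m" using insert.prems by (auto simp: dyadics_def)
  have "\<exists>k::nat. d = real k / 2 ^ (M + m)" if "d \<in> insert x D" for d
  proof (cases "d = x")
    case True
    then show ?thesis using x by (intro exI[of _ "l * 2 ^ M"]) (simp add: power_add)
  next
    case False
    then have "d \<in> D" using that by simp
    then obtain k where "d = real k / 2 ^ M" using M by blast
    then show ?thesis by (intro exI[of _ "k * 2 ^ m"]) (simp add: power_add)
  qed
  then show ?case by blast
qed auto

section \<open>Derivatives with values in the powers of two\<close>

text \<open>Darboux's argument: \<open>g\<close> attains its minimum on the interval, the signs of
  the derivative exclude both ends, and at an interior minimum the derivative vanishes.\<close>

lemma deriv_intermediate_zero:
  fixes g g' :: "real \<Rightarrow> real"
  assumes "x < y" "\<And>z. z \<in> {x..y} \<Longrightarrow> (g has_real_derivative g' z) (at z)" "g' x < 0" "g' y > 0"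
  obtains z where "z \<in> {x..y}" "g' z = 0"
proof -
  have "continuous_on {x..y} g"
    using assms(2) DERIV_isCont by (intro continuous_at_imp_continuous_on) blast
  then obtain z where z: "z \<in> {x..y}" "\<And>w. w \<in> {x..y} \<Longrightarrow> g z \<le> g w"
    using continuous_attains_inf[of "{x..y}" g] assms(1) by auto
  obtain d where d: "d > 0" "\<And>h. 0 < h \<Longrightarrow> h < d \<Longrightarrow> g (x + h) < g x"
    using DERIV_neg_dec_right[OF assms(2)[of x] assms(3)] assms(1) by auto
  obtain e where e: "e > 0" "\<And>h. 0 < h \<Longrightarrow> h < e \<Longrightarrow> g (y - h) < g y"
    using DERIV_pos_inc_left[OF assms(2)[of y] assms(4)] assms(1) by auto
  have "z \<noteq> x"
  proof
    assume "z = x"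
    define h where "h = min d (y - x) / 2"
    have "0 < h" "h < d" "h < y - x" using d(1) assms(1) by (auto simp: h_def min_def)
    then show False using z(2)[of "x + h"] d(2)[of h] \<open>z = x\<close> by simp
  qed
  moreover have "z \<noteq> y"
  proof
    assume "z = y"
    define h where "h = min e (y - x) / 2"
    have "0 < h" "h < e" "h < y - x" using e(1) assms(1) by (auto simp: h_def min_def)
    then show False using z(2)[of "y - h"] e(2)[of h] \<open>z = y\<close> by simp
  qed
  ultimately have "x < z" "z < y" using z(1) by auto
  then have "g' z = 0"
    using z DERIV_local_min[OF assms(2)[OF z(1)], of "min (z - x) (y - z)"]
    by (auto simp: abs_if split: if_splits)
  then show ?thesis using that z(1) by blast
qed

text \<open>A derivative takes all intermediate values even if it is not continuous, but there is a
  gap between consecutive powers of two. So the exponent cannot change inside the interval.\<close>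

lemma deriv_power_of_two_constant:
  fixes f :: "real \<Rightarrow> real"
  assumes ab: "a < b" and der: "\<And>t. t \<in> {a<..<b} \<Longrightarrow> \<exists>k::int. (f has_real_derivative 2 powi k) (at t)"
  obtains k :: int where "\<And>t. t \<in> {a<..<b} \<Longrightarrow> (f has_real_derivative 2 powi k) (at t)"
proof -
  obtain K where K: "\<And>t. t \<in> {a<..<b} \<Longrightarrow> (f has_real_derivative 2 powi K t) (at t)"
    using der by metis
  have powi_between: "2 powi l \<le> (2::real) powi k \<or> 2 * 2 powi k \<le> (2::real) powi l" for k l :: int
  proof (cases "l \<le> k")
    case False
    then have "(2::real) powi (k + 1) \<le> 2 powi l" by (intro power_int_increasing) auto
    then show ?thesis by (simp add: power_int_add)
  qed (simp add: power_int_increasing)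
  have "K x = K y" if xy: "x < y" "x \<in> {a<..<b}" "y \<in> {a<..<b}" for x y
  proof (rule ccontr)
    assume "K x \<noteq> K y"
    then consider "K x < K y" | "K y < K x" by linarith
    then show False
    proof cases
      case 1
      \<comment> \<open>Three halves of a power of two lies strictly between it and the next one, so
        it is not a slope of \<open>f\<close>; subtracting \<open>c * t\<close> turns the jump of
        slopes into a change of sign.\<close>
      define c where "c = 3/2 * (2::real) powi K x"
      have "2 * 2 powi K x \<le> (2::real) powi K y"
        using powi_between[of "K y" "K x"] power_int_strict_increasing[OF 1, of "2::real"] by simp
      moreover have "(2::real) powi K x > 0" by simp
      ultimately have c: "2 powi K x < c" "c < 2 powi K y" unfolding c_def by linarith+
      have der: "((\<lambda>t. f t - c * t) has_real_derivative (2 powi K z - c)) (at z)" if "z \<in> {x..y}" for z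
        using xy that by (auto intro!: derivative_eq_intros K)
      obtain z where "2 powi K z - c = 0"
        by (rule deriv_intermediate_zero[OF xy(1) der]) (use c in auto)
      then show False using powi_between[of "K z" "K x"] \<open>(2::real) powi K x > 0\<close>
        unfolding c_def by linarith
    next
      case 2
      define c where "c = 3/2 * (2::real) powi K y"
      have "2 * 2 powi K y \<le> (2::real) powi K x"
        using powi_between[of "K x" "K y"] power_int_strict_increasing[OF 2, of "2::real"] by simp
      moreover have "(2::real) powi K y > 0" by simp
      ultimately have c: "2 powi K y < c" "c < 2 powi K x" unfolding c_def by linarith+
      have der: "((\<lambda>t. c * t - f t) has_real_derivative (c - 2 powi K z)) (at z)" if "z \<in> {x..y}" for z
        using xy that by (auto intro!: derivative_eq_intros K)
      obtain z where "c - 2 powi K z = 0"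
        by (rule deriv_intermediate_zero[OF xy(1) der]) (use c in auto)
      then show False using powi_between[of "K z" "K y"] \<open>(2::real) powi K y > 0\<close> unfolding c_def by linarith
    qed
  qed
  then have const: "K x = K y" if "x \<in> {a<..<b}" "y \<in> {a<..<b}" for x y
    using that by (metis linorder_neqE)
  have "(a + b) / 2 \<in> {a<..<b}" using ab by simp
  then show ?thesis using that[of "K ((a + b) / 2)"] K const by metis
qed

text \<open>After subtraction of the linear part the derivative is zero inside; continuity extends
  the constancy to the end points, where nothing is known about the derivative.\<close>

lemma affine_of_deriv_power_of_two:
  fixes f :: "real \<Rightarrow> real"
  assumes ab: "a < b" and cont: "continuous_on {a..b} f"
    and der: "\<And>t. t \<in> {a<..<b} \<Longrightarrow> \<exists>k::int. (f has_real_derivative 2 powi k) (at t)"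
  shows "\<exists>k::int. \<forall>t\<in>{a..b}. f t = f a + 2 powi k * (t - a)"
proof -
  obtain k where k: "\<And>t. t \<in> {a<..<b} \<Longrightarrow> (f has_real_derivative 2 powi k) (at t)"
    using deriv_power_of_two_constant[OF ab der] by blast
  let ?g = "\<lambda>t. f t - 2 powi k * t"
  have "?g t = ?g a" if "t \<in> {a..b}" for t
  proof (rule DERIV_isconst2[OF ab])
    show "continuous_on {a..b} ?g" by (intro continuous_intros cont)
    show "(?g has_real_derivative 0) (at x)" if "a < x" "x < b" for x
      using that by (auto intro!: derivative_eq_intros k)
  qed (use that in auto)
  then show ?thesis by (intro exI[of _ k] ballI) (force simp: algebra_simps)
qed

section \<open>Thompson's group through dyadic grids\<close>

text \<open>On the cells given by a common denominator of the exceptional points \<open>f\<close> is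
  affine with slope a power of two. Going from cell to cell, starting at \<open>f 0 = 0\<close>,
  shows that the values at grid points are dyadic; a further subdivision makes every image a dyadic
  cell.\<close>

lemma thompson_F_set_dyadic_grid_map:
  assumes "f \<in> thompson_F_set"
  shows "f 0 = 0" "f 1 = 1" "\<exists>N. dyadic_grid_map f N"
proof -
  have f: "f ` {0..1} = {0..1}" "strict_mono_on {0..1} f" "continuous_on {0..1} f"
    using assms by (auto simp: thompson_F_set_def)
  obtain D where D: "finite D" "D \<subseteq> dyadics"
    "\<And>t. t \<in> {0..1} - D \<Longrightarrow> \<exists>k::int. (f has_real_derivative 2 powi k) (at t within {0..1})"
    using assms by (auto simp: thompson_F_set_def)
  have le: "x \<le> y \<Longrightarrow> x \<in> {0..1} \<Longrightarrow> y \<in> {0..1} \<Longrightarrow> f x \<le> f y" for x y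
    using strict_mono_onD[OF f(2), of x y] by (cases "x = y") auto
  have in01: "f t \<in> {0..1}" if "t \<in> {0..1}" for t using f(1) that by blast
  show f0: "f 0 = 0"
  proof -
    obtain y where "y \<in> {0..1}" "f y = 0" using f(1) by (metis atLeastAtMost_iff imageE order_refl zero_le_one)
    then show ?thesis using le[of 0 y] in01[of 0] by auto
  qed
  show "f 1 = 1"
  proof -
    obtain y where "y \<in> {0..1}" "f y = 1" using f(1) by (metis atLeastAtMost_iff imageE order_refl zero_le_one)
    then show ?thesis using le[of y 1] in01[of 1] by auto
  qed
  obtain M where M: "\<And>d. d \<in> D \<Longrightarrow> \<exists>k::nat. d = real k / 2 ^ M"
    using dyadics_common_denominator[OF D(1,2)] by blast
  have cell: "0 \<le> real j / 2 ^ M" "(real j + 1) / 2 ^ M \<le> 1" if "j < 2 ^ M" for j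
    using cell_in_unit[OF that, of 0] cell_in_unit[OF that, of 1] by auto
  have affine: "\<exists>k::int. \<forall>t\<in>{real j / 2 ^ M..(real j + 1) / 2 ^ M}. f t = f (real j / 2 ^ M) + 2 powi k * (t - real j / 2 ^ M)"
    if j: "j < 2 ^ M" for j
  proof -
    let ?a = "real j / 2 ^ M" and ?b = "(real j + 1) / 2 ^ M"
    have "?a < ?b" by (simp add: divide_strict_right_mono)
    moreover have "continuous_on {?a..?b} f"
      using continuous_on_subset[OF f(3)] cell[OF j] by auto
    moreover have "\<exists>k::int. (f has_real_derivative 2 powi k) (at t)" if t: "t \<in> {?a<..<?b}" for t
    proof -
      have "t \<notin> D"
      proof
        assume "t \<in> D"
        then obtain k :: nat where "t = real k / 2 ^ M" using M by blast
        with t have "real j < real k" "real k < real (j + 1)" by (auto simp: divide_less_cancel)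
        then show False by (simp only: of_nat_less_iff)
      qed
      moreover have "0 < t" "t < 1" using t cell[OF j] unfolding greaterThanLessThan_iff by linarith+
      ultimately show ?thesis using D(3)[of t] at_within_Icc_at[of 0 t 1] by auto
    qed
    ultimately show ?thesis by (intro affine_of_deriv_power_of_two) simp_all
  qed
  have powi: "\<exists>a b. (2::real) powi k = 2 ^ a / 2 ^ b" for k :: int
  proof (cases "k \<ge> 0")
    case True
    then show ?thesis by (intro exI[of _ "nat k"] exI[of _ 0]) (simp add: power_int_def)
  next
    case False
    then have "(2::real) powi k = inverse 2 ^ nat (- k)" by (simp add: power_int_def)
    also have "\<dots> = 2 ^ 0 / 2 ^ nat (- k)" by (simp only: inverse_eq_divide power_one_over power_0)
    finally show ?thesis by blast
  qed
  have dyadic: "\<exists>p q. f (real j / 2 ^ M) = real p / 2 ^ q" if "j \<le> 2 ^ M" for j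
    using that
  proof (induction j)
    case 0
    then show ?case using f0 by (intro exI[of _ 0]) simp
  next
    case (Suc j)
    then obtain p q where pq: "f (real j / 2 ^ M) = real p / 2 ^ q" by auto
    obtain k where k: "f ((real j + 1) / 2 ^ M) = f (real j / 2 ^ M) + 2 powi k * ((real j + 1) / 2 ^ M - real j / 2 ^ M)"
    proof -
      have "(real j + 1) / 2 ^ M \<in> {real j / 2 ^ M..(real j + 1) / 2 ^ M}" by (simp add: divide_right_mono)
      with affine[of j] Suc.prems show thesis by (metis Suc_le_lessD that)
    qed
    obtain a b where ab: "(2::real) powi k = 2 ^ a / 2 ^ b" using powi by blast
    have "(real j + 1) / 2 ^ M - real j / 2 ^ M = 1 / 2 ^ M" by (simp add: add_divide_distrib)
    then have "f (real (Suc j) / 2 ^ M) = real p / 2 ^ q + 2 ^ a / 2 ^ (b + M)"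
      using k pq ab by (simp add: power_add add.commute)
    also have "\<dots> = real (p * 2 ^ (b + M) + 2 ^ a * 2 ^ q) / 2 ^ (q + (b + M))"
      by (simp add: add_frac_eq power_add)
    finally show ?case by blast
  qed
  have "\<forall>\<^sub>F r in sequentially. \<forall>u<2 ^ r. \<exists>m' j'. canon f (M + r) (2 ^ r * j + u) m' j'" if j: "j < 2 ^ M" for j
  proof -
    obtain k where k: "\<And>t. t \<in> {real j / 2 ^ M..(real j + 1) / 2 ^ M} \<Longrightarrow>
        f t = f (real j / 2 ^ M) + 2 powi k * (t - real j / 2 ^ M)"
      using affine[OF j] by blast
    obtain p q where pq: "f (real j / 2 ^ M) = real p / 2 ^ q" using dyadic[of j] j by auto
    obtain a b where ab: "(2::real) powi k = 2 ^ a / 2 ^ b" using powi by blast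
    \<comment> \<open>The image of a subcell has width 2^-(b + M + r - a). For
      \<open>r \<ge> q + a\<close> the left value p/2^q is a multiple of this width, and none of the
      subtractions of naturals is truncated.\<close>
    have "canon f (M + r) (2 ^ r * j + u) (b + M + r - a) (p * 2 ^ (b + M + r - q - a) + u)"
      if r: "r \<ge> q + a" and u: "u < 2 ^ r" for r u
      unfolding canon_def
    proof
      fix s :: real assume s: "s \<in> {0..1}"
      let ?t = "(real (2 ^ r * j + u) + s) / 2 ^ (M + r)"
      define v where "v = (u + s) / 2 ^ r"
      have t: "?t = (real j + v) / 2 ^ M" by (simp add: v_def power_add field_simps)
      have v: "0 \<le> v" "v \<le> 1" using cell_in_unit[OF u, of s] s by (auto simp: v_def)
      then have "f ((real j + v) / 2 ^ M) = real p / 2 ^ q + 2 ^ a / 2 ^ b * ((real j + v) / 2 ^ M - real j / 2 ^ M)"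
        using k[of "(real j + v) / 2 ^ M"] by (simp add: pq ab divide_right_mono)
      then have "f ?t = real p / 2 ^ q + 2 ^ a / 2 ^ b * (v / 2 ^ M)"
        unfolding t by (simp add: add_divide_distrib)
      moreover have "real p / 2 ^ q = real p * 2 ^ (b + M + r - q - a) / 2 ^ (b + M + r - a)"
      proof -
        have "b + M + r - a = q + (b + M + r - q - a)" using r by simp
        then show ?thesis by (simp add: power_add)
      qed
      moreover have "2 ^ a / 2 ^ b * (v / 2 ^ M) = (u + s) / 2 ^ (b + M + r - a)"
      proof -
        have "(2::real) ^ b * 2 ^ M * 2 ^ r = 2 ^ a * 2 ^ (b + M + r - a)"
          using r by (simp add: power_add[symmetric])
        then show ?thesis unfolding v_def by (simp add: divide_simps) (simp add: algebra_simps)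
      qed
      ultimately show "f ?t = (real (p * 2 ^ (b + M + r - q - a) + u) + s) / 2 ^ (b + M + r - a)"
        by (simp add: add_divide_distrib)
    qed
    then show ?thesis unfolding eventually_sequentially by blast
  qed
  then have "\<forall>\<^sub>F r in sequentially. \<forall>j\<in>{..<2 ^ M}. \<forall>u<2 ^ r. \<exists>m' j'. canon f (M + r) (2 ^ r * j + u) m' j'"
    by (intro eventually_ball_finite) auto
  then obtain r where r: "\<And>j u. j < 2 ^ M \<Longrightarrow> u < 2 ^ r \<Longrightarrow> \<exists>m' j'. canon f (M + r) (2 ^ r * j + u) m' j'"
    unfolding eventually_sequentially by blast
  have "dyadic_grid_map f (M + r)"
    unfolding dyadic_grid_map_def
  proof (intro allI impI)
    fix i :: nat assume "i < 2 ^ (M + r)"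
    then show "\<exists>m' j'. canon f (M + r) i m' j'"
      using r[of "i div 2 ^ r" "i mod 2 ^ r"] div_less_power_add[of i M r] by auto
  qed
  then show "\<exists>N. dyadic_grid_map f N" by blast
qed

text \<open>Induction on the number of cells. \<open>canon\<close> describes \<open>f\<close> on
  closed cells, so neighbouring affine pieces agree at the grid point where they are glued.\<close>

lemma dyadic_grid_map_mono_continuous:
  assumes "dyadic_grid_map f M"
  shows "strict_mono_on {0..1} f" "continuous_on {0..1} f"
proof -
  have "strict_mono_on {0..real k / 2 ^ M} f \<and> continuous_on {0..real k / 2 ^ M} f" if "k \<le> 2 ^ M" for k
    using that
  proof (induction k)
    case 0
    then show ?case by (auto simp: strict_mono_on_def)
  next
    case (Suc k)
    let ?a = "real k / 2 ^ M" and ?b = "(real k + 1) / 2 ^ M"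
    have "k < 2 ^ M" using Suc.prems by simp
    then obtain m' j' where "canon f M k m' j'" using assms by (auto simp: dyadic_grid_map_def)
    note aff = canon_affine[OF this]
    have "continuous_on {?a..?b} f"
      using aff by (subst continuous_on_cong[OF HOL.refl aff]) (auto intro!: continuous_intros)
    then have "continuous_on ({0..?a} \<union> {?a..?b}) f"
      using Suc by (intro continuous_on_closed_Un) auto
    moreover have ab: "{0..?a} \<union> {?a..?b} = {0..?b}"
      by (intro ivl_disj_un_two_touch) (simp_all add: divide_right_mono)
    moreover have "f x < f y" if "x \<in> {0..?b}" "y \<in> {0..?b}" "x < y" for x y
    proof -
      have up: "f u < f v" if "u \<in> {?a..?b}" "v \<in> {?a..?b}" "u < v" for u v
        using that aff by (simp add: divide_strict_right_mono)
      have low: "f u < f v" if "u \<in> {0..?a}" "v \<in> {0..?a}" "u < v" for u v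
        using Suc that by (auto intro: strict_mono_onD)
      have a: "?a \<in> {0..?a}" "?a \<in> {?a..?b}" by (auto simp: divide_right_mono)
      show ?thesis
      proof (cases "x < ?a \<and> ?a < y")
        case True
        then show ?thesis using low[of x ?a] up[of ?a y] that a by auto
      next
        case False
        then show ?thesis using low[of x y] up[of x y] that by (auto simp: not_less)
      qed
    qed
    ultimately show ?case by (simp add: strict_mono_on_def add.commute)
  qed
  from this[of "2 ^ M"] show "strict_mono_on {0..1} f" "continuous_on {0..1} f" by auto
qed

lemma dyadic_grid_map_thompson_F_set:
  assumes grid: "dyadic_grid_map f M" and ext: "f \<in> extensional {0..1}" and f01: "f 0 = 0" "f 1 = 1"
  shows "f \<in> thompson_F_set"
proof -
  note mono = dyadic_grid_map_mono_continuous(1)[OF grid]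
  note cont = dyadic_grid_map_mono_continuous(2)[OF grid]
  have le: "x \<le> y \<Longrightarrow> x \<in> {0..1} \<Longrightarrow> y \<in> {0..1} \<Longrightarrow> f x \<le> f y" for x y
    using strict_mono_onD[OF mono, of x y] by (cases "x = y") auto
  have img: "f ` {0..1} = {0..1}"
  proof
    show "f ` {0..1} \<subseteq> {0..1}" using le[of 0] le[of _ 1] f01 by auto
    show "{0..1} \<subseteq> f ` {0..1}"
      using IVT'[of f 0 _ 1] cont f01 by fastforce
  qed
  \<comment> \<open>The grid points serve as break points and also as the exceptional points of
    differentiability.\<close>
  let ?P = "(\<lambda>j. real j / 2 ^ M) ` {..2 ^ M}"
  have pl: "\<exists>m c. \<forall>t\<in>{a..b}. f t = m * t + c"
    if ab: "a < b" "{a..b} \<subseteq> {0..1}" "{a<..<b} \<inter> ?P = {}" for a b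
  proof -
    have "a \<in> {0..<1}" using ab by auto
    then obtain j s where j: "j < 2 ^ M" "0 \<le> s" "s < 1" "a = (real j + s) / 2 ^ M"
      by (rule dyadic_cell_cases)
    have "real j / 2 ^ M \<le> a" "a < (real j + 1) / 2 ^ M" using j by (auto simp: divide_right_mono divide_strict_right_mono)
    moreover have "(real j + 1) / 2 ^ M \<in> ?P" using j(1) by (intro image_eqI[of _ _ "Suc j"]) auto
    then have "b \<le> (real j + 1) / 2 ^ M" using ab(3) calculation by (force simp: not_le)
    moreover obtain m' j' where "canon f M j m' j'" using j(1) grid by (auto simp: dyadic_grid_map_def)
    ultimately have "\<forall>t\<in>{a..b}. f t = (2 ^ M / 2 ^ m') * t + (real j' - real j) / 2 ^ m'"
      using canon_affine[of f M j m' j'] by simp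
    then show ?thesis by blast
  qed
  have der: "\<exists>k::int. (f has_real_derivative 2 powi k) (at t within {0..1})" if t: "t \<in> {0..1} - ?P" for t
  proof -
    have "t \<noteq> 1" using t by (auto simp: image_iff dest!: bspec[of _ _ "2 ^ M"])
    then have "t \<in> {0..<1}" using t by auto
    then obtain j s where j: "j < 2 ^ M" "0 \<le> s" "s < 1" "t = (real j + s) / 2 ^ M"
      by (rule dyadic_cell_cases)
    moreover have "s \<noteq> 0" using t j by auto
    ultimately have int: "t \<in> {real j / 2 ^ M<..<(real j + 1) / 2 ^ M}" by (auto simp: divide_strict_right_mono)
    obtain m' j' where c: "canon f M j m' j'" using j(1) grid by (auto simp: dyadic_grid_map_def)
    have "((\<lambda>t. (2 ^ M / 2 ^ m') * t + (real j' - real j) / 2 ^ m') has_real_derivative 2 ^ M / 2 ^ m') (at t)"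
      by (auto intro!: derivative_eq_intros)
    then have "(f has_real_derivative 2 ^ M / 2 ^ m') (at t)"
      by (rule has_field_derivative_transform_within_open[OF _ _ int]) (use canon_affine[OF c] in auto)
    moreover have "(2::real) ^ M / 2 ^ m' = 2 powi (int M - int m')" by (simp add: power_int_diff)
    ultimately show ?thesis using has_field_derivative_at_within by metis
  qed
  have P: "?P \<subseteq> dyadics" unfolding dyadics_def by auto
  have "piecewise_linear_on {0..1} f"
    unfolding piecewise_linear_on_def by (intro exI[of _ ?P]) (use pl in auto)
  moreover have "\<exists>D. finite D \<and> D \<subseteq> dyadics \<and>
      (\<forall>t\<in>{0..1} - D. \<exists>k::int. (f has_real_derivative 2 powi k) (at t within {0..1}))"
    by (rule exI[of _ ?P], intro conjI ballI der P finite_imageI finite_atMost)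
  ultimately show ?thesis unfolding thompson_F_set_def using ext img mono cont by simp
qed

text \<open>The form of membership in which closure under products, inverses and insertion into a
  cell is checked, cell by cell.\<close>

lemma thompson_F_set_iff:
  "f \<in> thompson_F_set \<longleftrightarrow> f \<in> extensional {0..1} \<and> f 0 = 0 \<and> f 1 = 1 \<and> (\<exists>M. dyadic_grid_map f M)"
proof
  assume "f \<in> thompson_F_set"
  then show "f \<in> extensional {0..1} \<and> f 0 = 0 \<and> f 1 = 1 \<and> (\<exists>M. dyadic_grid_map f M)"
    using thompson_F_set_dyadic_grid_map[of f] by (simp add: thompson_F_set_def)
qed (use dyadic_grid_map_thompson_F_set in blast)

section \<open>Order properties, and closure under composition and inversion\<close>

lemma thompson_F_set_strict_mono: "f \<in> thompson_F_set \<Longrightarrow> strict_mono_on {0..1} f"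
  by (simp add: thompson_F_set_def)

lemma thompson_F_set_mono:
  "f \<in> thompson_F_set \<Longrightarrow> x \<in> {0..1} \<Longrightarrow> y \<in> {0..1} \<Longrightarrow> x \<le> y \<Longrightarrow> f x \<le> f y"
  using strict_mono_onD[OF thompson_F_set_strict_mono, of f x y] by (cases "x = y") auto

lemma thompson_F_set_Bij: "thompson_F_set \<subseteq> Bij {0..1}"
  by (auto simp: thompson_F_set_def Bij_def bij_betw_def strict_mono_on_imp_inj_on)

lemma thompson_F_set_closed: "f \<in> thompson_F_set \<Longrightarrow> t \<in> {0..1} \<Longrightarrow> f t \<in> {0..1}"
  by (auto simp: thompson_F_set_def)

lemma canon_target_less:
  assumes "f \<in> thompson_F_set" "canon f m j m' j'" "j < 2 ^ m"
  shows "j' < 2 ^ m'"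
proof -
  have "(real j' + 1) / 2 ^ m' \<le> 1"
    using thompson_F_set_closed[OF assms(1) cell_in_unit[OF assms(3), of 1]] canonD[OF assms(2), of 1] by simp
  then have "real (j' + 1) \<le> real (2 ^ m')" by simp
  then show ?thesis by (simp only: of_nat_le_iff)
qed

text \<open>Refining the grid of \<open>g\<close> by \<open>K\<close> levels also refines its target
  cells by \<open>K\<close> levels, so each of them has level at least \<open>K\<close>, where
  \<open>f\<close> is canonical.\<close>

lemma compose_in_thompson_F_set:
  assumes f: "f \<in> thompson_F_set" and g: "g \<in> thompson_F_set"
  shows "compose {0..1} f g \<in> thompson_F_set"
proof -
  obtain K where K: "dyadic_grid_map f K" using f by (auto simp: thompson_F_set_iff)
  obtain M where M: "dyadic_grid_map g M" using g by (auto simp: thompson_F_set_iff)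
  have "\<exists>m' j'. canon (compose {0..1} f g) (M + K) i m' j'" if i: "i < 2 ^ (M + K)" for i
  proof -
    obtain m j where "canon g M (i div 2 ^ K) m j"
      using M div_less_power_add[OF i] unfolding dyadic_grid_map_def by blast
    from canon_subcell[OF this, of "i mod 2 ^ K" K]
    have gi: "canon g (M + K) i (m + K) (2 ^ K * j + i mod 2 ^ K)" by simp
    have "dyadic_grid_map f (m + K)" using dyadic_grid_map_refine[OF K] by simp
    then obtain m' j' where fj: "canon f (m + K) (2 ^ K * j + i mod 2 ^ K) m' j'"
      using canon_target_less[OF g gi i] by (auto simp: dyadic_grid_map_def)
    have "canon (compose {0..1} f g) (M + K) i m' j'"
      unfolding canon_def
    proof
      fix s :: real assume "s \<in> {0..1}"
      then show "compose {0..1} f g ((real i + s) / 2 ^ (M + K)) = (real j' + s) / 2 ^ m'"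
        using cell_in_unit[OF i, of s] canonD[OF gi, of s] canonD[OF fj, of s] by (simp add: compose_def)
    qed
    then show ?thesis by blast
  qed
  then have "dyadic_grid_map (compose {0..1} f g) (M + K)" by (simp add: dyadic_grid_map_def)
  then show ?thesis using f g by (auto simp: thompson_F_set_iff compose_def)
qed

lemma canon_inverse:
  assumes f: "f \<in> thompson_F_set" and c: "canon f m j m' j'" and j: "j < 2 ^ m"
  shows "canon (restrict (inv_into {0..1} f) {0..1}) m' j' m j"
  unfolding canon_def
proof
  fix s :: real assume s: "s \<in> {0..1}"
  let ?t = "(real j + s) / 2 ^ m"
  have t: "?t \<in> {0..1}" using cell_in_unit[OF j] s by simp
  then have "inv_into {0..1} f (f ?t) = ?t"
    using thompson_F_set_Bij f by (intro inv_into_f_f) (auto simp: Bij_def bij_betw_def)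
  then show "restrict (inv_into {0..1} f) {0..1} ((real j' + s) / 2 ^ m') = ?t"
    using thompson_F_set_closed[OF f t] canonD[OF c, of s] s by simp
qed

text \<open>The target cells of \<open>f\<close> have different levels. Each cell of the finest
  occurring level \<open>L\<close> lies in one target cell, and it corresponds to a subcell of the
  matching source cell.\<close>

lemma inverse_in_thompson_F_set:
  assumes f: "f \<in> thompson_F_set"
  shows "restrict (inv_into {0..1} f) {0..1} \<in> thompson_F_set"
proof -
  let ?g = "restrict (inv_into {0..1} f) {0..1}"
  have bij: "inj_on f {0..1}" "f ` {0..1} = {0..1}"
    using thompson_F_set_Bij f by (auto simp: Bij_def bij_betw_def)
  obtain M where M: "dyadic_grid_map f M" using f by (auto simp: thompson_F_set_iff)
  then obtain mt jt where can: "\<And>j. j < 2 ^ M \<Longrightarrow> canon f M j (mt j) (jt j)"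
    unfolding dyadic_grid_map_def by metis
  define L where "L = Max (mt ` {..<2 ^ M})"
  have L: "mt j \<le> L" if "j < 2 ^ M" for j using that by (auto simp: L_def)
  have "\<exists>m' j'. canon ?g L p m' j'" if p: "p < 2 ^ L" for p
  proof -
    \<comment> \<open>The midpoint of cell \<open>p\<close> decides which target cell contains
      \<open>p\<close>: the half leaves strict inequalities that pin down the integers even if
      \<open>x\<close> lies at the end of a source cell.\<close>
    have "(real p + 1/2) / 2 ^ L \<in> f ` {0..1}" using cell_in_unit[OF p, of "1/2"] bij by simp
    then obtain x where x: "x \<in> {0..1}" "f x = (real p + 1/2) / 2 ^ L" by (metis imageE)
    obtain j s where j: "j < 2 ^ M" "0 \<le> s" "s \<le> 1" "x = (real j + s) / 2 ^ M"
      using x(1) by (rule dyadic_cell_cases')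
    define r where "r = L - mt j"
    have Lr: "L = mt j + r" using L[OF j(1)] by (simp add: r_def)
    have "real p + 1/2 = ((real p + 1/2) / 2 ^ L) * 2 ^ L" by simp
    also have "\<dots> = (real (jt j) + s) / 2 ^ mt j * 2 ^ L"
      using x canonD[OF can[OF j(1)] j(2,3)] j(4) by simp
    also have "\<dots> = 2 ^ r * (real (jt j) + s)" by (simp add: Lr power_add)
    finally have "real p + 1/2 = 2 ^ r * (real (jt j) + s)" .
    moreover have "2 ^ r * real (jt j) \<le> 2 ^ r * (real (jt j) + s)" 
      "2 ^ r * (real (jt j) + s) \<le> 2 ^ r * (real (jt j) + 1)"
      using j by (intro mult_left_mono; simp)+
    ultimately have "2 ^ r * real (jt j) < real p + 1" "real p < 2 ^ r * (real (jt j) + 1)" by linarith+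
    then have "real (2 ^ r * jt j) < real (p + 1)" "real p < real (2 ^ r * (jt j + 1))" by (simp_all add: distrib_left)
    then have "2 ^ r * jt j \<le> p" "p < 2 ^ r * jt j + 2 ^ r" by (simp_all only: of_nat_less_iff) simp_all
    then obtain u where u: "p = 2 ^ r * jt j + u" "u < 2 ^ r"
      using le_Suc_ex by fastforce
    have "canon f (M + r) (2 ^ r * j + u) L p"
      using canon_subcell[OF can[OF j(1)] u(2)] by (simp add: Lr u(1))
    moreover have "2 ^ r * j + u < 2 ^ (M + r)"
    proof -
      have "2 ^ r * (j + 1) \<le> (2::nat) ^ r * 2 ^ M" using j(1) by (intro mult_le_mono2) simp
      then show ?thesis using u(2) by (simp add: power_add mult.commute)
    qed
    ultimately show ?thesis using canon_inverse[OF f] by blast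
  qed
  then have "dyadic_grid_map ?g L" by (simp add: dyadic_grid_map_def)
  moreover have "inv_into {0..1} f 0 = 0" "inv_into {0..1} f 1 = 1"
    using inv_into_f_f[OF bij(1), of 0] inv_into_f_f[OF bij(1), of 1] f by (auto simp: thompson_F_set_iff)
  ultimately show ?thesis by (auto simp: thompson_F_set_iff)
qed

lemma identity_in_thompson_F_set: "(\<lambda>x\<in>{0..1}. x) \<in> thompson_F_set"
proof -
  have "dyadic_grid_map (\<lambda>x\<in>{0..1}. x) 0"
    unfolding dyadic_grid_map_def canon_def by (intro allI impI exI[of _ 0]) auto
  then show ?thesis by (auto simp: thompson_F_set_iff)
qed

section \<open>F as a group and computation in it\<close>

lemma subgroup_thompson_F: "subgroup thompson_F_set (BijGroup {0..1})"
proof (rule group.subgroupI[OF group_BijGroup])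
  show "thompson_F_set \<subseteq> carrier (BijGroup {0..1})" using thompson_F_set_Bij by (simp add: BijGroup_def)
  show "thompson_F_set \<noteq> {}" using identity_in_thompson_F_set by blast
  show "inv\<^bsub>BijGroup {0..1}\<^esub> f \<in> thompson_F_set" if "f \<in> thompson_F_set" for f
    using that thompson_F_set_Bij inverse_in_thompson_F_set by (subst inv_BijGroup) auto
  show "f \<otimes>\<^bsub>BijGroup {0..1}\<^esub> g \<in> thompson_F_set" if "f \<in> thompson_F_set" "g \<in> thompson_F_set" for f g
    using that thompson_F_set_Bij compose_in_thompson_F_set by (auto simp: BijGroup_def)
qed

lemma thompson_F_group: "group thompson_F"
  unfolding thompson_F_def by (rule group.subgroup_imp_group[OF group_BijGroup subgroup_thompson_F])

interpretation thompson_F: group thompson_F by (rule thompson_F_group)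

lemma thompson_F_carrier: "carrier thompson_F = thompson_F_set"
  by (simp add: thompson_F_def)

lemma thompson_F_mult_apply:
  assumes "f \<in> thompson_F_set" "g \<in> thompson_F_set" "t \<in> {0..1}"
  shows "(f \<otimes>\<^bsub>thompson_F\<^esub> g) t = f (g t)"
  using assms thompson_F_set_Bij by (auto simp: thompson_F_def BijGroup_def compose_def)

lemma thompson_F_one_apply: "t \<in> {0..1} \<Longrightarrow> \<one>\<^bsub>thompson_F\<^esub> t = t"
  by (simp add: thompson_F_def BijGroup_def)

lemma thompson_F_inv:
  assumes "f \<in> thompson_F_set"
  shows "inv\<^bsub>thompson_F\<^esub> f = restrict (inv_into {0..1} f) {0..1}"
  using assms group.m_inv_consistent[OF group_BijGroup subgroup_thompson_F] inv_BijGroup thompson_F_set_Bij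
  by (auto simp: thompson_F_def)

lemma thompson_F_inv_closed: "f \<in> thompson_F_set \<Longrightarrow> inv\<^bsub>thompson_F\<^esub> f \<in> thompson_F_set"
  using thompson_F.inv_closed by (simp add: thompson_F_carrier)

lemma thompson_F_mult_closed:
  "f \<in> thompson_F_set \<Longrightarrow> g \<in> thompson_F_set \<Longrightarrow> f \<otimes>\<^bsub>thompson_F\<^esub> g \<in> thompson_F_set"
  using thompson_F.m_closed by (simp add: thompson_F_carrier)

lemma thompson_F_inv_apply:
  assumes "f \<in> thompson_F_set" "t \<in> {0..1}"
  shows "(inv\<^bsub>thompson_F\<^esub> f) (f t) = t" "f ((inv\<^bsub>thompson_F\<^esub> f) t) = t"
  using assms thompson_F_mult_apply[of "inv\<^bsub>thompson_F\<^esub> f" f t] thompson_F_mult_apply[of f "inv\<^bsub>thompson_F\<^esub> f" t]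
  by (simp_all add: thompson_F_inv_closed thompson_F_one_apply thompson_F.l_inv thompson_F.r_inv thompson_F_carrier)

lemma thompson_F_eqI:
  assumes "f \<in> thompson_F_set" "g \<in> thompson_F_set" "\<And>t. t \<in> {0..1} \<Longrightarrow> f t = g t"
  shows "f = g"
  using assms by (intro extensionalityI[of f "{0..1}"]) (auto simp: thompson_F_set_def)

section \<open>Generation by the standard generators\<close>

text \<open>A scaled copy of \<open>f\<close> inside one dyadic cell, with the identity elsewhere.
  The cell [1/2,1] serves the proof of generation, and copies of \<open>thompson_x0\<close> in small
  cells are the bumps that detect a centralizer.\<close>

definition insert_cell :: "nat \<Rightarrow> nat \<Rightarrow> (real \<Rightarrow> real) \<Rightarrow> real \<Rightarrow> real" where
  "insert_cell m j f = (\<lambda>t\<in>{0..1}. if t \<in> {real j / 2 ^ m..(real j + 1) / 2 ^ m}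
     then (real j + f (2 ^ m * t - real j)) / 2 ^ m else t)"

lemma insert_cell_inside:
  assumes "j < 2 ^ m" "s \<in> {0..1}"
  shows "insert_cell m j f ((real j + s) / 2 ^ m) = (real j + f s) / 2 ^ m"
  using cell_in_unit[OF assms(1), of s] assms(2)
  by (auto simp: insert_cell_def divide_right_mono)

lemma insert_cell_outside:
  assumes "f 0 = 0" "f 1 = 1" "t \<in> {0..1}" "t \<notin> {real j / 2 ^ m<..<(real j + 1) / 2 ^ m}"
  shows "insert_cell m j f t = t"
proof -
  consider "t = real j / 2 ^ m" | "t = (real j + 1) / 2 ^ m" | "t \<notin> {real j / 2 ^ m..(real j + 1) / 2 ^ m}"
    using assms(4) by fastforce
  then show ?thesis by cases (use assms(1-3) in \<open>auto simp: insert_cell_def\<close>)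
qed

lemma canon_insert_cell:
  assumes "canon f M u m' u'" "u < 2 ^ M" "j < 2 ^ m"
  shows "canon (insert_cell m j f) (m + M) (2 ^ M * j + u) (m + m') (2 ^ m' * j + u')"
  unfolding canon_def
proof
  fix s :: real assume s: "s \<in> {0..1}"
  have "(real (2 ^ M * j + u) + s) / 2 ^ (m + M) = (real j + (real u + s) / 2 ^ M) / 2 ^ m"
    "(real (2 ^ m' * j + u') + s) / 2 ^ (m + m') = (real j + (real u' + s) / 2 ^ m') / 2 ^ m"
    by (simp_all add: power_add field_simps)
  then show "insert_cell m j f ((real (2 ^ M * j + u) + s) / 2 ^ (m + M)) = (real (2 ^ m' * j + u') + s) / 2 ^ (m + m')"
    using insert_cell_inside[OF assms(3) cell_in_unit[OF assms(2), of s]] canonD[OF assms(1), of s] s by simp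
qed

text \<open>At level \<open>m + M\<close> the cells inside the chosen cell carry the cell maps of
  \<open>f\<close>, and all others are mapped to themselves.\<close>

lemma insert_cell_in_thompson_F_set:
  assumes f: "f \<in> thompson_F_set" and j: "j < 2 ^ m"
  shows "insert_cell m j f \<in> thompson_F_set"
proof -
  have f01: "f 0 = 0" "f 1 = 1" using f by (auto simp: thompson_F_set_iff)
  obtain M where M: "dyadic_grid_map f M" using f by (auto simp: thompson_F_set_iff)
  have "\<exists>m' j'. canon (insert_cell m j f) (m + M) i m' j'" if i: "i < 2 ^ (m + M)" for i
  proof (cases "i div 2 ^ M = j")
    case True
    have "i mod 2 ^ M < 2 ^ M" by simp
    then obtain m' u' where "canon f M (i mod 2 ^ M) m' u'" using M unfolding dyadic_grid_map_def by blast
    from canon_insert_cell[OF this _ j] show ?thesis using True by (intro exI) auto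
  next
    case False
    have "canon (insert_cell m j f) (m + M) i (m + M) i"
      unfolding canon_def
    proof
      fix s :: real assume s: "s \<in> {0..1}"
      let ?u = "i mod 2 ^ M" and ?d = "i div 2 ^ M" and ?t = "(real i + s) / 2 ^ (m + M)"
      have "real i = real (2 ^ M * ?d + ?u)" by (simp only: mult_div_mod_eq)
      then have "real i = 2 ^ M * real ?d + real ?u"
        by (simp only: of_nat_add of_nat_mult of_nat_power of_nat_numeral)
      then have t: "?t = (real ?d + (real ?u + s) / 2 ^ M) / 2 ^ m" by (simp add: power_add field_simps)
      have u: "(real ?u + s) / 2 ^ M \<in> {0..1}" using s by (intro cell_in_unit) auto
      \<comment> \<open>\<open>?t\<close> lies in the cell \<open>?d\<close> of level
        \<open>m\<close>; distinct cells of one level meet at most in an end point, and end points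
        are fixed.\<close>
      have "?t \<notin> {real j / 2 ^ m<..<(real j + 1) / 2 ^ m}"
      proof
        assume "?t \<in> {real j / 2 ^ m<..<(real j + 1) / 2 ^ m}"
        then have "real j < real ?d + (real ?u + s) / 2 ^ M" "real ?d + (real ?u + s) / 2 ^ M < real j + 1"
          unfolding t by (auto simp: divide_less_cancel)
        then have "real j < real ?d + 1" "real ?d < real j + 1"
          using u unfolding atLeastAtMost_iff by linarith+
        then have "real j < real (?d + 1)" "real ?d < real (j + 1)" by simp_all
        then show False using False by (simp only: of_nat_less_iff)
      qed
      then show "insert_cell m j f ?t = ?t"
        using insert_cell_outside[OF f01 cell_in_unit[OF i]] s by simp
    qed
    then show ?thesis by blast
  qed
  then have "dyadic_grid_map (insert_cell m j f) (m + M)" by (simp add: dyadic_grid_map_def)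
  moreover have "insert_cell m j f 0 = 0"
    by (rule insert_cell_outside[OF f01]) (simp_all add: not_less)
  moreover have "insert_cell m j f 1 = 1"
  proof (rule insert_cell_outside[OF f01])
    show "1 \<notin> {real j / 2 ^ m<..<(real j + 1) / 2 ^ m}"
      using cell_in_unit[OF j, of 1] by auto
  qed simp
  ultimately show ?thesis by (auto simp: thompson_F_set_iff insert_cell_def)
qed

section \<open>The standard generators on cells\<close>

lemma canon_thompson_x0:
  "canon thompson_x0 1 0 2 0" "canon thompson_x0 2 2 2 1" "canon thompson_x0 2 3 1 1"
  by (auto simp: canon_def thompson_x0_def power2_eq_square field_simps)

lemma thompson_x0_in_thompson_F_set: "thompson_x0 \<in> thompson_F_set"
proof -
  have "\<exists>m' j'. canon thompson_x0 2 j m' j'" if "j < 2 ^ 2" for j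
  proof -
    \<comment> \<open>The piece on [0,1/2] is a single cell of level 1; its two halves provide the
      cells 0 and 1 of the grid of level 2.\<close>
    have "j = 0 \<or> j = 1 \<or> j = 2 \<or> j = 3" using that by auto
    then show ?thesis
      using canon_thompson_x0 canon_subcell[OF canon_thompson_x0(1), of 0 1] canon_subcell[OF canon_thompson_x0(1), of 1 1]
      by (auto simp: numeral_2_eq_2)
  qed
  then have "dyadic_grid_map thompson_x0 2" by (simp add: dyadic_grid_map_def)
  then show ?thesis by (auto simp: thompson_F_set_iff thompson_x0_def)
qed

text \<open>This makes insertion into the upper half send one generator to the other.\<close>

lemma thompson_x1_eq: "thompson_x1 = insert_cell 1 1 thompson_x0"
  by (rule extensionalityI[of _ "{0..1}"])
    (auto simp: thompson_x1_def insert_cell_def thompson_x0_def field_simps)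

lemma thompson_x1_in_thompson_F_set: "thompson_x1 \<in> thompson_F_set"
  unfolding thompson_x1_eq by (rule insert_cell_in_thompson_F_set[OF thompson_x0_in_thompson_F_set]) simp

lemma insert_cell_mult:
  assumes f: "f \<in> thompson_F_set" and g: "g \<in> thompson_F_set" and j: "j < 2 ^ m"
  shows "insert_cell m j (f \<otimes>\<^bsub>thompson_F\<^esub> g) = insert_cell m j f \<otimes>\<^bsub>thompson_F\<^esub> insert_cell m j g"
proof (rule thompson_F_eqI)
  note ins = insert_cell_in_thompson_F_set[OF _ j]
  have fg: "f \<otimes>\<^bsub>thompson_F\<^esub> g \<in> thompson_F_set" using f g by (rule thompson_F_mult_closed)
  then show "insert_cell m j (f \<otimes>\<^bsub>thompson_F\<^esub> g) \<in> thompson_F_set" by (rule ins)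
  show "insert_cell m j f \<otimes>\<^bsub>thompson_F\<^esub> insert_cell m j g \<in> thompson_F_set"
    using ins f g thompson_F_mult_closed by blast
  fix t :: real assume t: "t \<in> {0..1}"
  show "insert_cell m j (f \<otimes>\<^bsub>thompson_F\<^esub> g) t = (insert_cell m j f \<otimes>\<^bsub>thompson_F\<^esub> insert_cell m j g) t"
  proof (cases "t \<in> {real j / 2 ^ m<..<(real j + 1) / 2 ^ m}")
    case True
    define s where "s = 2 ^ m * t - real j"
    have s: "s \<in> {0..1}" "t = (real j + s) / 2 ^ m" using True by (auto simp: s_def field_simps)
    show ?thesis
      using s(1) j thompson_F_set_closed[OF g s(1)]
      by (subst thompson_F_mult_apply[OF ins[OF f] ins[OF g] t])
        (simp only: s(2) insert_cell_inside thompson_F_mult_apply[OF f g s(1)])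
  next
    case False
    have "insert_cell m j h t = t" if "h \<in> thompson_F_set" for h
      using that t False by (intro insert_cell_outside) (simp_all add: thompson_F_set_iff)
    then show ?thesis using f g fg t by (simp add: thompson_F_mult_apply ins)
  qed
qed

definition thompson_std :: "(real \<Rightarrow> real) set" where
  "thompson_std = generate thompson_F {thompson_x0, thompson_x1}"

lemma thompson_std_generators: "thompson_x0 \<in> thompson_std" "thompson_x1 \<in> thompson_std"
  unfolding thompson_std_def by (auto intro: generate.incl)

lemma thompson_std_subgroup: "subgroup thompson_std thompson_F"
  unfolding thompson_std_def
  by (rule thompson_F.generate_is_subgroup)
    (simp add: thompson_F_carrier thompson_x0_in_thompson_F_set thompson_x1_in_thompson_F_set)

text \<open>The inserted element is the usual x2 = x0^-1 x1 x0: x0 maps [3/4,1] affinely onto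
  [1/2,1], where x1 is a copy of x0, so conjugation moves this copy to [3/4,1].\<close>

lemma insert_cell_thompson_x1:
  "insert_cell 1 1 thompson_x1 =
     inv\<^bsub>thompson_F\<^esub> thompson_x0 \<otimes>\<^bsub>thompson_F\<^esub> (thompson_x1 \<otimes>\<^bsub>thompson_F\<^esub> thompson_x0)"
proof -
  let ?y = "insert_cell 1 1 thompson_x1"
  note x = thompson_x0_in_thompson_F_set thompson_x1_in_thompson_F_set
  have y: "?y \<in> thompson_F_set" using insert_cell_in_thompson_F_set[OF x(2), of 1 1] by simp
  have "thompson_x0 \<otimes>\<^bsub>thompson_F\<^esub> ?y = thompson_x1 \<otimes>\<^bsub>thompson_F\<^esub> thompson_x0"
  proof (rule thompson_F_eqI)
    fix t :: real assume t: "t \<in> {0..1}"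
    show "(thompson_x0 \<otimes>\<^bsub>thompson_F\<^esub> ?y) t = (thompson_x1 \<otimes>\<^bsub>thompson_F\<^esub> thompson_x0) t"
      unfolding thompson_F_mult_apply[OF x(1) y t] thompson_F_mult_apply[OF x(2,1) t]
      using t by (auto simp: thompson_x0_def thompson_x1_def insert_cell_def field_simps)
  qed (intro thompson_F_mult_closed x y)+
  then show ?thesis
    using x y thompson_F.inv_solve_left[of ?y thompson_x0 "thompson_x1 \<otimes>\<^bsub>thompson_F\<^esub> thompson_x0"]
    by (simp add: thompson_F_carrier thompson_F_mult_closed del: One_nat_def)
qed

text \<open>Insertion is an endomorphism of F, so the generators suffice: x0 goes to x1, and x1 goes
  to the conjugate just computed.\<close>

lemma insert_cell_thompson_std:
  assumes "f \<in> thompson_std"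
  shows "insert_cell 1 1 f \<in> thompson_std"
proof -
  have hom: "group_hom thompson_F thompson_F (insert_cell 1 1)"
    using insert_cell_in_thompson_F_set[of _ 1 1] insert_cell_mult[of _ _ 1 1]
    by unfold_locales (simp_all add: hom_def thompson_F_carrier)
  have "insert_cell 1 1 thompson_x1 \<in> thompson_std"
    unfolding insert_cell_thompson_x1
    by (intro subgroup.m_closed[OF thompson_std_subgroup] subgroup.m_inv_closed[OF thompson_std_subgroup]
        thompson_std_generators)
  then have "generate thompson_F (insert_cell 1 1 ` {thompson_x0, thompson_x1}) \<subseteq> thompson_std"
    using thompson_std_generators
    by (intro thompson_F.generate_subgroup_incl[OF _ thompson_std_subgroup]) (auto simp: thompson_x1_eq[symmetric] simp del: One_nat_def)
  moreover have "generate thompson_F (insert_cell 1 1 ` {thompson_x0, thompson_x1}) = insert_cell 1 1 ` thompson_std"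
    unfolding thompson_std_def
    by (rule group_hom.generate_img[OF hom])
      (simp add: thompson_F_carrier thompson_x0_in_thompson_F_set thompson_x1_in_thompson_F_set)
  ultimately show ?thesis using assms by blast
qed

text \<open>
  A covering of \<open>[0,1)\<close> by cells on which \<open>f\<close> is canonical, as quadruples
  \<open>(source level, source index, target level, target index)\<close>.
\<close>
definition canon_cover :: "(real \<Rightarrow> real) \<Rightarrow> (nat \<times> nat \<times> nat \<times> nat) set \<Rightarrow> bool" where
  "canon_cover f C \<longleftrightarrow> finite C \<and> (\<forall>(m, j, m', j') \<in> C. j < 2 ^ m \<and> canon f m j m' j') \<and>
     (\<forall>t\<in>{0..<1}. \<exists>m j m' j' s. (m, j, m', j') \<in> C \<and> 0 \<le> s \<and> s < 1 \<and> t = (real j + s) / 2 ^ m)"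

text \<open>Cells of a cover may overlap, so several can begin at 0. The widest of them is singled
  out; its two levels measure the progress of the reduction.\<close>

definition largest_first_cell :: "(nat \<times> nat \<times> nat \<times> nat) set \<Rightarrow> nat \<Rightarrow> nat \<Rightarrow> bool" where
  "largest_first_cell C m m' \<longleftrightarrow> (m, 0, m', 0) \<in> C \<and> (\<forall>k k' j'. (k, 0, k', j') \<in> C \<longrightarrow> m \<le> k)"

lemma canon_coverD:
  assumes "canon_cover f C" "(m, j, m', j') \<in> C"
  shows "j < 2 ^ m" "canon f m j m' j'"
  using assms by (auto simp: canon_cover_def)

lemma canon_coverE:
  assumes "canon_cover f C" "t \<in> {0..<1}"
  obtains m j m' j' s where "(m, j, m', j') \<in> C" "0 \<le> s" "s < 1" "t = (real j + s) / 2 ^ m"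
  using assms unfolding canon_cover_def by meson

lemma canon_start:
  assumes "f \<in> thompson_F_set" "canon f m j m' j'" "j < 2 ^ m"
  shows "j = 0 \<longleftrightarrow> j' = 0"
proof -
  have "f (real j / 2 ^ m) = real j' / 2 ^ m'" using canonD[OF assms(2), of 0] by simp
  moreover have "f 0 = 0" using assms(1) by (simp add: thompson_F_set_iff)
  moreover have "f (real j / 2 ^ m) > f 0" if "j \<noteq> 0"
    using strict_mono_onD[OF thompson_F_set_strict_mono[OF assms(1)], of 0 "real j / 2 ^ m"]
      cell_in_unit[OF assms(3), of 0] that by simp
  ultimately show ?thesis by (cases "j = 0"; cases "j' = 0") auto
qed

text \<open>Both cells determine the slope of \<open>f\<close> at 0, as 2^(m - m') and as 2^(k -
  k'); the comparison is made at the common point 1/2^(m + k).\<close>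

lemma canon_start_slope:
  assumes "canon f m 0 m' 0" "canon f k 0 k' 0"
  shows "m + k' = k + m'"
proof -
  have "(1::real) / 2 ^ (k + m') = 1 / 2 ^ (m + k')"
    using canonD[OF assms(1), of "1 / 2 ^ k"] canonD[OF assms(2), of "1 / 2 ^ m"]
    by (simp add: power_add mult.commute)
  then have "(2::real) ^ (k + m') = 2 ^ (m + k')" by (simp add: field_simps)
  then show ?thesis by (simp add: power_inject_exp)
qed

text \<open>The affine pieces of x0 have the images [0,1/4], [1/4,1/2] and [1/2,1]. Every dyadic
  cell other than [0,1] and [0,1/2] lies in one of them and can be pulled back.\<close>

lemma thompson_x0_canon_preimage:
  assumes "j < 2 ^ k" "k \<noteq> 0" "(k, j) \<noteq> (1, 0)"
  shows "\<exists>k' j'. j' < 2 ^ k' \<and> canon thompson_x0 k' j' k j"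
proof -
  consider (right) r u where "k = 1 + r" "j = 2 ^ r + u" "u < 2 ^ r"
    | (middle) r u where "k = 2 + r" "j = 2 ^ r + u" "u < 2 ^ r"
    | (left) r where "k = 2 + r" "j < 2 ^ r"
  proof -
    obtain k1 where k1: "k = 1 + k1" using assms(2) by (metis Suc_eq_plus1_left not0_implies_Suc)
    show thesis
    proof (cases "j < 2 ^ k1")
      case False
      then obtain u where u: "j = 2 ^ k1 + u" using le_Suc_ex not_less by blast
      then show thesis using right[of k1 u] k1 assms(1) by simp
    next
      case True
      have "k1 \<noteq> 0" using True k1 assms(3) by (intro notI) simp
      then obtain r where r: "k1 = 1 + r" by (metis Suc_eq_plus1_left not0_implies_Suc)
      show thesis
      proof (cases "j < 2 ^ r")
        case False
        then obtain u where u: "j = 2 ^ r + u" using le_Suc_ex not_less by blast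
        then show thesis using middle[of r u] k1 r True by simp
      qed (use left[of r] k1 r in simp)
    qed
  qed
  then show ?thesis
  proof cases
    case right
    then have "canon thompson_x0 (2 + r) (2 ^ r * 3 + u) k j"
      using canon_subcell[OF canon_thompson_x0(3), of u r] by simp
    moreover have "2 ^ r * 3 + u < 2 ^ (2 + r)" using right by simp
    ultimately show ?thesis by blast
  next
    case middle
    then have "canon thompson_x0 (2 + r) (2 ^ r * 2 + u) k j"
      using canon_subcell[OF canon_thompson_x0(2), of u r] by simp
    moreover have "2 ^ r * 2 + u < 2 ^ (2 + r)" using middle by simp
    ultimately show ?thesis by blast
  next
    case left
    then have "canon thompson_x0 (1 + r) j k j"
      using canon_subcell[OF canon_thompson_x0(1), of j r] by simp
    moreover have "j < 2 ^ (1 + r)" using left by simp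
    ultimately show ?thesis by blast
  qed
qed

text \<open>All source cells are pulled back through x0. The two cells without preimage begin at 0
  and are wider than the first cell of level at least 2, so they do not occur. As x0 has slope 1/2
  at 0, the first source level falls by one.\<close>

lemma canon_cover_mult_x0:
  assumes f: "f \<in> thompson_F_set" and C: "canon_cover f C" "largest_first_cell C (Suc (Suc m)) m'"
  shows "\<exists>C'. canon_cover (f \<otimes>\<^bsub>thompson_F\<^esub> thompson_x0) C' \<and> card C' \<le> card C \<and>
    largest_first_cell C' (Suc m) m'"
proof -
  note x0 = thompson_x0_in_thompson_F_set
  have "\<exists>q. snd q < 2 ^ fst q \<and> canon thompson_x0 (fst q) (snd q) k j" if c: "(k, j, k', j') \<in> C" for k j k' j'
  proof -
    have "j < 2 ^ k" using canon_coverD[OF C(1) c] by simp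
    moreover have "k \<noteq> 0 \<and> (k, j) \<noteq> (1, 0)"
    proof (intro conjI notI)
      assume "k = 0"
      then have "(0, 0, k', j') \<in> C" using c \<open>j < 2 ^ k\<close> by simp
      then show False using C(2) by (force simp: largest_first_cell_def)
    next
      assume "(k, j) = (1, 0)"
      then show False using C(2) c by (force simp: largest_first_cell_def)
    qed
    ultimately show ?thesis using thompson_x0_canon_preimage[of j k] by auto
  qed
  then obtain p where p: "\<And>k j k' j'. (k, j, k', j') \<in> C \<Longrightarrow>
      snd (p k j) < 2 ^ fst (p k j) \<and> canon thompson_x0 (fst (p k j)) (snd (p k j)) k j"
    by metis
  define C' where "C' = (\<lambda>(k, j, k', j'). (fst (p k j), snd (p k j), k', j')) ` C"
  have fin: "finite C" using C(1) by (simp add: canon_cover_def)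
  have first: "snd (p k j) = 0 \<longleftrightarrow> j = 0" "j = 0 \<Longrightarrow> k = Suc (fst (p k j))" if c: "(k, j, k', j') \<in> C" for k j k' j'
  proof -
    show eq: "snd (p k j) = 0 \<longleftrightarrow> j = 0" by (rule canon_start[OF x0 conjunct2[OF p[OF c]] conjunct1[OF p[OF c]]])
    show "k = Suc (fst (p k j))" if "j = 0"
      using canon_start_slope[OF canon_thompson_x0(1), of "fst (p k j)" k] p[OF c] eq that by simp
  qed
  have "canon_cover (f \<otimes>\<^bsub>thompson_F\<^esub> thompson_x0) C'"
    unfolding canon_cover_def
  proof (intro conjI ballI)
    show "finite C'" using fin by (simp add: C'_def)
  next
    fix c assume "c \<in> C'"
    then obtain k j k' j' where c: "(k, j, k', j') \<in> C" "c = (fst (p k j), snd (p k j), k', j')"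
      by (auto simp: C'_def)
    have "canon (f \<otimes>\<^bsub>thompson_F\<^esub> thompson_x0) (fst (p k j)) (snd (p k j)) k' j'"
      unfolding canon_def
    proof
      fix s :: real assume s: "s \<in> {0..1}"
      then show "(f \<otimes>\<^bsub>thompson_F\<^esub> thompson_x0) ((real (snd (p k j)) + s) / 2 ^ fst (p k j)) = (real j' + s) / 2 ^ k'"
        using thompson_F_mult_apply[OF f x0 cell_in_unit, of "snd (p k j)" "fst (p k j)" s] p[OF c(1)]
          canonD[of thompson_x0 "fst (p k j)" "snd (p k j)" k j s] canonD[OF canon_coverD(2)[OF C(1) c(1)], of s]
        by simp
    qed
    then show "case c of (m, j, m', j') \<Rightarrow> j < 2 ^ m \<and> canon (f \<otimes>\<^bsub>thompson_F\<^esub> thompson_x0) m j m' j'"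
      using c p[OF c(1)] by simp
  next
    fix t :: real assume t: "t \<in> {0..<1}"
    have "thompson_x0 t < 1" "thompson_x0 t \<ge> 0" using t by (auto simp: thompson_x0_def)
    then obtain k j k' j' s where c: "(k, j, k', j') \<in> C" "0 \<le> s" "s < 1" "thompson_x0 t = (real j + s) / 2 ^ k"
      using canon_coverE[OF C(1), of "thompson_x0 t"] by (metis atLeastLessThan_iff)
    have "thompson_x0 ((real (snd (p k j)) + s) / 2 ^ fst (p k j)) = thompson_x0 t"
      using p[OF c(1)] c canonD[of thompson_x0 "fst (p k j)" "snd (p k j)" k j s] by simp
    moreover have "inj_on thompson_x0 {0..1}"
      using strict_mono_on_imp_inj_on[OF thompson_F_set_strict_mono[OF x0]] .
    ultimately have "t = (real (snd (p k j)) + s) / 2 ^ fst (p k j)"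
      using inj_onD[of thompson_x0 "{0..1}" "(real (snd (p k j)) + s) / 2 ^ fst (p k j)" t]
        t c p[OF c(1)] cell_in_unit[of "snd (p k j)" "fst (p k j)" s] by simp
    then show "\<exists>m j m' j' s. (m, j, m', j') \<in> C' \<and> 0 \<le> s \<and> s < 1 \<and> t = (real j + s) / 2 ^ m"
      using c unfolding C'_def by force
  qed
  moreover have "card C' \<le> card C" unfolding C'_def using fin by (rule card_image_le)
  moreover have "largest_first_cell C' (Suc m) m'"
    unfolding largest_first_cell_def
  proof (intro conjI allI impI)
    have c: "(Suc (Suc m), 0, m', 0) \<in> C" using C(2) by (simp add: largest_first_cell_def)
    show "(Suc m, 0, m', 0) \<in> C'" using first[OF c] c unfolding C'_def by force
  next
    fix k k' j' assume "(k, 0, k', j') \<in> C'"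
    then obtain l j where c: "(l, j, k', j') \<in> C" "k = fst (p l j)" "snd (p l j) = 0" by (auto simp: C'_def)
    then have "j = 0" "l = Suc k" using first[OF c(1)] by auto
    then show "Suc m \<le> k" using C(2) c(1) by (force simp: largest_first_cell_def)
  qed
  ultimately show ?thesis by blast
qed

text \<open>Exchanging source and target covers the inverse. The chosen cell stays the widest at 0,
  because all cells there have the same difference of levels, given by the slope at 0.\<close>

lemma canon_cover_inv:
  assumes f: "f \<in> thompson_F_set" and C: "canon_cover f C" "largest_first_cell C m m'"
  shows "\<exists>C'. canon_cover (inv\<^bsub>thompson_F\<^esub> f) C' \<and> card C' \<le> card C \<and> largest_first_cell C' m' m"
proof -
  define C' where "C' = (\<lambda>(k, j, k', j'). (k', j', k, j)) ` C"
  have fin: "finite C" using C(1) by (simp add: canon_cover_def)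
  have "canon_cover (inv\<^bsub>thompson_F\<^esub> f) C'"
    unfolding canon_cover_def
  proof (intro conjI ballI)
    show "finite C'" using fin by (simp add: C'_def)
  next
    fix c assume "c \<in> C'"
    then obtain k j k' j' where c: "(k, j, k', j') \<in> C" "c = (k', j', k, j)" by (auto simp: C'_def)
    note can = canon_coverD(2)[OF C(1) c(1)] canon_coverD(1)[OF C(1) c(1)]
    show "case c of (m, j, m', j') \<Rightarrow> j < 2 ^ m \<and> canon (inv\<^bsub>thompson_F\<^esub> f) m j m' j'"
      using canon_target_less[OF f can] canon_inverse[OF f can] by (simp add: c(2) thompson_F_inv[OF f])
  next
    fix t :: real assume t: "t \<in> {0..<1}"
    then have "t \<in> f ` {0..1}" using f by (simp add: thompson_F_set_def)
    then obtain x where x: "x \<in> {0..1}" "t = f x" by blast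
    moreover have "x \<noteq> 1" using x t f by (auto simp: thompson_F_set_iff)
    ultimately have "x \<in> {0..<1}" by auto
    then obtain k j k' j' s where c: "(k, j, k', j') \<in> C" "0 \<le> s" "s < 1" "x = (real j + s) / 2 ^ k"
      by (rule canon_coverE[OF C(1)])
    then have "t = (real j' + s) / 2 ^ k'" using x canonD[OF canon_coverD(2)[OF C(1) c(1)], of s] by simp
    then show "\<exists>m j m' j' s. (m, j, m', j') \<in> C' \<and> 0 \<le> s \<and> s < 1 \<and> t = (real j + s) / 2 ^ m"
      using c unfolding C'_def by force
  qed
  moreover have "card C' \<le> card C" unfolding C'_def using fin by (rule card_image_le)
  moreover have "largest_first_cell C' m' m"
    unfolding largest_first_cell_def
  proof (intro conjI allI impI)
    have c: "(m, 0, m', 0) \<in> C" using C(2) by (simp add: largest_first_cell_def)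
    then show "(m', 0, m, 0) \<in> C'" unfolding C'_def by force
    fix k k' j' assume "(k, 0, k', j') \<in> C'"
    then have c': "(k', j', k, 0) \<in> C" by (auto simp: C'_def)
    then have "j' = 0" using canon_start[OF f] canon_coverD[OF C(1) c'] by blast
    then have "m \<le> k'" "m + k = k' + m'"
      using C(2) c' canon_start_slope[of f m m' k' k] canon_coverD(2)[OF C(1)] c
      by (auto simp: largest_first_cell_def)
    then show "m' \<le> k" by simp
  qed
  ultimately show ?thesis by blast
qed

text \<open>\<open>h\<close> is the upper half of \<open>f\<close> stretched to [0,1]. Since
  \<open>f\<close> fixes 1/2 and increases, a cell in the upper half has its target there too, so
  both levels can be lowered by one and the indices shifted.\<close>

lemma insert_upper_half:
  assumes f: "f \<in> thompson_F_set" and fixed: "\<And>t. 0 \<le> t \<Longrightarrow> t \<le> 1/2 \<Longrightarrow> f t = t"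
  defines "h \<equiv> \<lambda>t\<in>{0..1}. 2 * f ((1 + t) / 2) - 1"
  shows "h \<in> thompson_F_set" "f = insert_cell 1 1 h"
    "canon f (Suc k) (2 ^ k + i) m' j' \<Longrightarrow> i < 2 ^ k \<Longrightarrow>
       \<exists>k' i'. m' = Suc k' \<and> j' = 2 ^ k' + i' \<and> canon h k i k' i'"
proof -
  show can: "\<exists>k' i'. m' = Suc k' \<and> j' = 2 ^ k' + i' \<and> canon h k i k' i'"
    if c: "canon f (Suc k) (2 ^ k + i) m' j'" and i: "i < 2 ^ k" for k i m' j'
  proof -
    have "2 ^ k + i < 2 ^ Suc k" using i by simp
    note less = canon_target_less[OF f c this] and unit = cell_in_unit[OF this]
    have "f (1/2) \<le> f ((real (2 ^ k + i) + 0) / 2 ^ Suc k)"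
      using unit[of 0] by (intro thompson_F_set_mono[OF f]) (auto simp: field_simps)
    also have "\<dots> = real j' / 2 ^ m'" using canonD[OF c, of 0] by simp
    finally have half: "2 ^ m' \<le> 2 * real j'" using fixed[of "1/2"] by (simp add: field_simps)
    then have "m' \<noteq> 0" using less by (intro notI) simp
    then obtain k' where k': "m' = Suc k'" by (metis not0_implies_Suc)
    have "real (2 ^ k') \<le> real j'" using half k' by simp
    then have "2 ^ k' \<le> j'" by (simp only: of_nat_le_iff)
    then obtain i' where i': "j' = 2 ^ k' + i'" using le_Suc_ex by blast
    have "canon h k i k' i'"
      unfolding canon_def
    proof
      fix s :: real assume s: "s \<in> {0..1}"
      have eq: "(1 + (real i + s) / 2 ^ k) / 2 = (real (2 ^ k + i) + s) / 2 ^ Suc k"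
        by (simp add: field_simps)
      have "(real i + s) / 2 ^ k \<in> {0..1}" using cell_in_unit[OF i, of s] s by simp
      then have "h ((real i + s) / 2 ^ k) = 2 * f ((real (2 ^ k + i) + s) / 2 ^ Suc k) - 1"
        unfolding h_def by (simp only: restrict_apply' eq)
      also have "\<dots> = 2 * ((real (2 ^ k' + i') + s) / 2 ^ Suc k') - 1"
        using canonD[OF c, of s] s by (simp add: k' i')
      also have "\<dots> = (real i' + s) / 2 ^ k'" by (simp add: field_simps)
      finally show "h ((real i + s) / 2 ^ k) = (real i' + s) / 2 ^ k'" .
    qed
    then show ?thesis using k' i' by blast
  qed
  obtain M where "dyadic_grid_map f M" using f by (auto simp: thompson_F_set_iff)
  then have M: "dyadic_grid_map f (Suc M)" by (rule dyadic_grid_map_refine) simp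
  have "dyadic_grid_map h M"
    unfolding dyadic_grid_map_def
  proof (intro allI impI)
    fix i :: nat assume i: "i < 2 ^ M"
    then have "2 ^ M + i < 2 ^ Suc M" by simp
    then show "\<exists>m' j'. canon h M i m' j'" using M can i unfolding dyadic_grid_map_def by blast
  qed
  moreover have "h 0 = 0" "h 1 = 1" using fixed[of "1/2"] f by (auto simp: h_def thompson_F_set_iff)
  ultimately show h: "h \<in> thompson_F_set" by (auto simp: thompson_F_set_iff h_def)
  show "f = insert_cell 1 1 h"
  proof (rule thompson_F_eqI[OF f])
    show "insert_cell 1 1 h \<in> thompson_F_set" by (rule insert_cell_in_thompson_F_set[OF h]) simp
    fix t :: real assume t: "t \<in> {0..1}"
    show "f t = insert_cell 1 1 h t"
    proof (cases "t \<le> 1/2")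
      case True
      then show ?thesis
        using t fixed insert_cell_outside[of h t 1 1] h by (simp add: thompson_F_set_iff)
    next
      case False
      then show ?thesis using t by (simp add: insert_cell_def h_def)
    qed
  qed
qed

lemma largest_first_cell_exists:
  assumes f: "f \<in> thompson_F_set" and C: "canon_cover f C"
  shows "\<exists>m m'. largest_first_cell C m m'"
proof -
  obtain k j k' j' s where "(k, j, k', j') \<in> C" "0 \<le> s" "0 = (real j + s) / 2 ^ k"
    using canon_coverE[OF C, of 0] by (metis atLeastLessThan_iff order_refl zero_less_one)
  then have ex: "\<exists>k' j'. (k, 0, k', j') \<in> C" by (cases "j = 0") (auto simp: add_nonneg_eq_0_iff)
  define m where "m = (LEAST k. \<exists>k' j'. (k, 0, k', j') \<in> C)"
  obtain m' j' where m: "(m, 0, m', j') \<in> C"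
    using LeastI[of "\<lambda>k. \<exists>k' j'. (k, 0, k', j') \<in> C", OF ex] unfolding m_def by blast
  moreover have "j' = 0" using canon_start[OF f] canon_coverD[OF C m] by blast
  moreover have "m \<le> k" if "(k, 0, k', j') \<in> C" for k k' j'
    unfolding m_def by (rule Least_le) (use that in blast)
  ultimately show ?thesis unfolding largest_first_cell_def by blast
qed

text \<open>The cells in the upper half, rescaled, cover \<open>h\<close>. The cell [0,1/2] belongs
  to \<open>C\<close> and is discarded, which gives the strict decrease; the whole interval is not a
  cell of \<open>C\<close>, as it would be wider than the first cell.\<close>

lemma canon_cover_upper_half:
  assumes f: "f \<in> thompson_F_set" and fixed: "\<And>t. 0 \<le> t \<Longrightarrow> t \<le> 1/2 \<Longrightarrow> f t = t"
    and C: "canon_cover f C" "largest_first_cell C 1 m'"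
  defines "h \<equiv> \<lambda>t\<in>{0..1}. 2 * f ((1 + t) / 2) - 1"
  shows "\<exists>C'. canon_cover h C' \<and> card C' < card C"
proof -
  note upper = insert_upper_half[OF f fixed, folded h_def]
  \<comment> \<open>The inequality on \<open>j\<close> says that the cell lies in [1/2,1].\<close>
  define C0 where "C0 = {(k, j, k', j') |k j k' j'. (k, j, k', j') \<in> C \<and> k \<noteq> 0 \<and> 2 ^ (k - 1) \<le> j}"
  define C' where "C' = (\<lambda>(k, j, k', j'). (k - 1, j - 2 ^ (k - 1), k' - 1, j' - 2 ^ (k' - 1))) ` C0"
  have fin: "finite C" using C(1) by (simp add: canon_cover_def)
  have C0: "C0 \<subset> C" 
  proof
    show "C0 \<subseteq> C" by (auto simp: C0_def)
    have "(1, 0, m', 0) \<in> C" using C(2) by (simp add: largest_first_cell_def)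
    moreover have "(1, 0, m', 0) \<notin> C0" by (simp add: C0_def)
    ultimately show "C0 \<noteq> C" by blast
  qed
  have "canon_cover h C'"
    unfolding canon_cover_def
  proof (intro conjI ballI)
    show "finite C'" using fin C0 unfolding C'_def by (meson finite_imageI finite_subset psubset_imp_subset)
  next
    fix c assume "c \<in> C'"
    then obtain k j k' j' where c: "(k, j, k', j') \<in> C" "k \<noteq> 0" "2 ^ (k - 1) \<le> j"
      "c = (k - 1, j - 2 ^ (k - 1), k' - 1, j' - 2 ^ (k' - 1))"
      by (auto simp: C'_def C0_def)
    obtain l where l: "k = Suc l" using c(2) by (metis not0_implies_Suc)
    obtain i where i: "j = 2 ^ l + i" using c(3) l le_Suc_ex by auto
    have "i < 2 ^ l" "canon f (Suc l) (2 ^ l + i) k' j'" using canon_coverD[OF C(1) c(1)] by (auto simp: l i)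
    then show "case c of (m, j, m', j') \<Rightarrow> j < 2 ^ m \<and> canon h m j m' j'"
      using upper(3) c(4) by (fastforce simp: l i)
  next
    fix t :: real assume t: "t \<in> {0..<1}"
    then have "(1 + t) / 2 \<in> {0..<1}" by auto
    then obtain k j k' j' s where c: "(k, j, k', j') \<in> C" "0 \<le> s" "s < 1" "(1 + t) / 2 = (real j + s) / 2 ^ k"
      by (rule canon_coverE[OF C(1)])
    have "k \<noteq> 0"
    proof
      assume "k = 0"
      then have "(0, 0, k', j') \<in> C" using c(1) canon_coverD(1)[OF C(1) c(1)] by auto
      then show False using C(2) by (force simp: largest_first_cell_def)
    qed
    then obtain l where l: "k = Suc l" by (metis not0_implies_Suc)
    have eq: "2 ^ l * (1 + t) = real j + s" using c(4) l by (simp add: field_simps)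
    have "2 ^ l * 1 \<le> 2 ^ l * (1 + t)" using t by simp
    then have "real (2 ^ l) < real (j + 1)" using eq c(3) by simp
    then have "2 ^ l \<le> j" by (simp only: of_nat_less_iff)
    then have "(l, j - 2 ^ l, k' - 1, j' - 2 ^ (k' - 1)) \<in> C'"
      using c(1) l unfolding C'_def C0_def by force
    moreover have "t = (real (j - 2 ^ l) + s) / 2 ^ l"
      using eq \<open>2 ^ l \<le> j\<close> by (simp add: of_nat_diff field_simps)
    ultimately show "\<exists>m j m' j' s. (m, j, m', j') \<in> C' \<and> 0 \<le> s \<and> s < 1 \<and> t = (real j + s) / 2 ^ m"
      using c(2,3) by blast
  qed
  moreover have "card C' < card C"
  proof -
    have "card C' \<le> card C0" unfolding C'_def using fin C0 by (meson card_image_le finite_subset psubset_imp_subset)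
    also have "\<dots> < card C" using fin C0 by (rule psubset_card_mono)
    finally show ?thesis .
  qed
  ultimately show ?thesis by blast
qed

text \<open>
  Multiplication by \<open>x\<^sub>0\<close>, applied to \<open>f\<close> or its inverse, enlarges the first source or target cell
  until both are \<open>[0,1/2]\<close>; then \<open>f\<close> is the identity there and its upper half, rescaled, has a
  smaller cover.
\<close>
lemma canon_cover_thompson_std:
  assumes "f \<in> thompson_F_set" "canon_cover f C"
  shows "f \<in> thompson_std"
  using assms
proof (induction "card C" arbitrary: f C rule: less_induct)
  case outer: less
  \<comment> \<open>Inner induction on the sum of the two levels of the first cell, for all elements
    with a cover no larger than \<open>C\<close>: factors x0 change the element but do not enlarge
    its cover.\<close>
  have "f' \<in> thompson_std"
    if "f' \<in> thompson_F_set" "canon_cover f' C'" "largest_first_cell C' m m'" "card C' \<le> card C" for f' C' m m'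
    using that
  proof (induction "m + m'" arbitrary: f' C' m m' rule: less_induct)
    case less
    note f = less.prems(1) and C = less.prems(2,3) and card = less.prems(4)
    note std = subgroup.m_closed[OF thompson_std_subgroup] subgroup.m_inv_closed[OF thompson_std_subgroup]
    have fc: "f' \<in> carrier thompson_F" "thompson_x0 \<in> carrier thompson_F"
      using f thompson_x0_in_thompson_F_set by (simp_all add: thompson_F_carrier)
    have can: "canon f' m 0 m' 0" using canon_coverD(2)[OF C(1)] C(2) by (simp add: largest_first_cell_def)
    consider (source) n where "m = Suc (Suc n)" | (target) n where "m' = Suc (Suc n)" | (small) "m \<le> 1" "m' \<le> 1"
      by (metis One_nat_def not0_implies_Suc le_SucI order_refl zero_le_one)
    then show ?case
    proof cases
      case source
      obtain C'' where C'': "canon_cover (f' \<otimes>\<^bsub>thompson_F\<^esub> thompson_x0) C''" "card C'' \<le> card C'"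
        "largest_first_cell C'' (Suc n) m'"
        using canon_cover_mult_x0[OF f C[unfolded source]] by blast
      have "f' \<otimes>\<^bsub>thompson_F\<^esub> thompson_x0 \<in> thompson_std"
        using less.hyps[OF _ _ C''(1,3)] C''(2) card f
        by (simp add: source thompson_F_mult_closed thompson_x0_in_thompson_F_set)
      from std(1)[OF this std(2)[OF thompson_std_generators(1)]]
      show ?thesis using fc by (simp add: thompson_F.m_assoc)
    next
      case target
      \<comment> \<open>The target level of an element is the source level of its inverse, so this
        case repeats the previous one for the inverse.\<close>
      obtain C1 where C1: "canon_cover (inv\<^bsub>thompson_F\<^esub> f') C1" "card C1 \<le> card C'"
        "largest_first_cell C1 (Suc (Suc n)) m"
        using canon_cover_inv[OF f C[unfolded target]] by blast
      let ?g = "inv\<^bsub>thompson_F\<^esub> f'"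
      have g: "?g \<in> thompson_F_set" using f by (rule thompson_F_inv_closed)
      obtain C'' where C'': "canon_cover (?g \<otimes>\<^bsub>thompson_F\<^esub> thompson_x0) C''" "card C'' \<le> card C1"
        "largest_first_cell C'' (Suc n) m"
        using canon_cover_mult_x0[OF g C1(1,3)] by blast
      have "?g \<otimes>\<^bsub>thompson_F\<^esub> thompson_x0 \<in> thompson_std"
        using less.hyps[OF _ _ C''(1,3)] C''(2) C1(2) card g
        by (simp add: target thompson_F_mult_closed thompson_x0_in_thompson_F_set)
      from std(1)[OF this std(2)[OF thompson_std_generators(1)]]
      have "?g \<in> thompson_std" using fc by (simp add: thompson_F.m_assoc)
      from std(2)[OF this] show ?thesis using fc by simp
    next
      case small
      have end1: "f' (1 / 2 ^ m) = 1 / 2 ^ m'" using canonD[OF can, of 1] by simp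
      have f1: "f' 1 = 1" using f by (simp add: thompson_F_set_iff)
      have inj: "inj_on f' {0..1}"
        using strict_mono_on_imp_inj_on[OF thompson_F_set_strict_mono[OF f]] .
      \<comment> \<open>Mixed levels would make \<open>f'\<close> take 1 to 1/2 or 1/2 to 1, against
        \<open>f' 1 = 1\<close> and injectivity.\<close>
      consider "m = 0" "m' = 0" | "m = 1" "m' = 1"
      proof (cases "m = 0")
        case True
        then have "2 ^ m' = (2::real) ^ 0" using end1 f1 by simp
        then have "m' = 0" by (subst (asm) power_inject_exp) simp_all
        then show thesis using that(1) True by simp
      next
        case False
        then have "m = 1" using small by simp
        moreover have "m' \<noteq> 0"
        proof
          assume "m' = 0"
          then have "f' (1/2) = f' 1" using end1 f1 \<open>m = 1\<close> by simp
          then show False using inj_onD[OF inj, of "1/2" 1] by simp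
        qed
        ultimately show thesis using that(2) small by simp
      qed
      then show ?thesis
      proof cases
        case 1
        have "f' t = t" if "t \<in> {0..1}" for t using canonD[OF can, of t] that 1 by simp
        then have "f' = \<one>\<^bsub>thompson_F\<^esub>"
          using f thompson_F.one_closed
          by (intro thompson_F_eqI) (auto simp: thompson_F_one_apply thompson_F_carrier)
        then show ?thesis using subgroup.one_closed[OF thompson_std_subgroup] by simp
      next
        case 2
        have fixed: "f' t = t" if "0 \<le> t" "t \<le> 1/2" for t using canonD[OF can, of "2 * t"] that 2 by simp
        define h where "h = (\<lambda>t\<in>{0..1}. 2 * f' ((1 + t) / 2) - 1)"
        obtain C'' where "canon_cover h C''" "card C'' < card C'"
          using canon_cover_upper_half[OF f fixed C[unfolded 2]] unfolding h_def by blast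
        moreover have "h \<in> thompson_F_set" "f' = insert_cell 1 1 h"
          using insert_upper_half(1,2)[OF f fixed] unfolding h_def by blast+
        ultimately show ?thesis using outer.hyps[of C'' h] card insert_cell_thompson_std by simp
      qed
    qed
  qed
  moreover obtain m m' where "largest_first_cell C m m'" using largest_first_cell_exists outer.prems by blast
  ultimately show ?case using outer.prems by blast
qed

theorem thompson_F_generated: "generate thompson_F {thompson_x0, thompson_x1} = carrier thompson_F"
proof
  show "generate thompson_F {thompson_x0, thompson_x1} \<subseteq> carrier thompson_F"
    using subgroup.subset[OF thompson_std_subgroup] by (simp add: thompson_std_def)
  show "carrier thompson_F \<subseteq> generate thompson_F {thompson_x0, thompson_x1}"
  proof
    fix f assume "f \<in> carrier thompson_F"
    then have f: "f \<in> thompson_F_set" by (simp add: thompson_F_carrier)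
    then obtain M where "dyadic_grid_map f M" by (auto simp: thompson_F_set_iff)
    then obtain k l where kl: "\<And>j. j < 2 ^ M \<Longrightarrow> canon f M j (k j) (l j)"
      unfolding dyadic_grid_map_def by metis
    have "canon_cover f ((\<lambda>j. (M, j, k j, l j)) ` {..<2 ^ M})"
      unfolding canon_cover_def
    proof (intro conjI ballI)
      fix t :: real assume "t \<in> {0..<1}"
      then obtain j s where "j < 2 ^ M" "0 \<le> s" "s < 1" "t = (real j + s) / 2 ^ M" by (rule dyadic_cell_cases)
      then show "\<exists>m j m' j' s. (m, j, m', j') \<in> (\<lambda>j. (M, j, k j, l j)) ` {..<2 ^ M} \<and>
          0 \<le> s \<and> s < 1 \<and> t = (real j + s) / 2 ^ m"
        by blast
    qed (use kl in auto)
    then show "f \<in> generate thompson_F {thompson_x0, thompson_x1}"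
      using canon_cover_thompson_std f by (simp add: thompson_std_def)
  qed
qed

section \<open>Elements supported on one side of a point\<close>

text \<open>The pointwise stabilizer of \<open>T\<close>; thus \<open>fixing {s..1}\<close> consists
  of the elements supported in [0,s], and \<open>fixing {0..s}\<close> of those supported in
  [s,1].\<close>

definition fixing :: "real set \<Rightarrow> (real \<Rightarrow> real) set" where
  "fixing T = {f \<in> thompson_F_set. \<forall>t\<in>T. f t = t}"

text \<open>Both elements preserve [0,s] and [s,1], and on each of these intervals one of them is
  the identity.\<close>

lemma fixing_left_right_commute:
  assumes s: "s \<in> {0..1}" and a: "a \<in> fixing {s..1}" and b: "b \<in> fixing {0..s}"
  shows "a \<otimes>\<^bsub>thompson_F\<^esub> b = b \<otimes>\<^bsub>thompson_F\<^esub> a"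
proof (rule thompson_F_eqI)
  have F: "a \<in> thompson_F_set" "b \<in> thompson_F_set" using a b by (auto simp: fixing_def)
  then show "a \<otimes>\<^bsub>thompson_F\<^esub> b \<in> thompson_F_set" "b \<otimes>\<^bsub>thompson_F\<^esub> a \<in> thompson_F_set"
    by (auto intro: thompson_F_mult_closed)
  fix t :: real assume t: "t \<in> {0..1}"
  have "a (b t) = b (a t)"
  proof (cases "t \<le> s")
    case True
    then have "a t \<le> a s" using thompson_F_set_mono[OF F(1)] s t by blast
    then have "a t \<in> {0..s}" using a s thompson_F_set_closed[OF F(1) t] by (auto simp: fixing_def)
    then show ?thesis using b t True by (simp add: fixing_def)
  next
    case False
    then have "b s \<le> b t" using thompson_F_set_mono[OF F(2)] s t by simp
    then have "b t \<in> {s..1}" using b s thompson_F_set_closed[OF F(2) t] by (auto simp: fixing_def)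
    then show ?thesis using a t False by (simp add: fixing_def)
  qed
  then show "(a \<otimes>\<^bsub>thompson_F\<^esub> b) t = (b \<otimes>\<^bsub>thompson_F\<^esub> a) t"
    using t by (simp add: thompson_F_mult_apply F)
qed

lemma conjugate_in_fixing:
  assumes c: "c \<in> thompson_F_set" and f: "f \<in> fixing T" and T: "T' \<subseteq> {0..1}"
    "\<And>t. t \<in> T' \<Longrightarrow> (inv\<^bsub>thompson_F\<^esub> c) t \<in> T"
  shows "c \<otimes>\<^bsub>thompson_F\<^esub> f \<otimes>\<^bsub>thompson_F\<^esub> inv\<^bsub>thompson_F\<^esub> c \<in> fixing T'"
proof -
  have F: "f \<in> thompson_F_set" using f by (simp add: fixing_def)
  note ic = thompson_F_inv_closed[OF c]
  show ?thesis
    using f T thompson_F_set_closed[OF ic] thompson_F_inv_apply(2)[OF c]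
    by (auto simp: fixing_def thompson_F_mult_closed c F ic thompson_F_mult_apply subset_iff)
qed

text \<open>Conjugation by \<open>c\<close> moves the support from [s,1] to [c s, 1], which is still
  contained in [s,1].\<close>

lemma conjugate_fixing_left:
  assumes c: "c \<in> thompson_F_set" and s: "s \<in> {0..1}" "s \<le> c s" and f: "f \<in> fixing {0..s}"
  shows "c \<otimes>\<^bsub>thompson_F\<^esub> f \<otimes>\<^bsub>thompson_F\<^esub> inv\<^bsub>thompson_F\<^esub> c \<in> fixing {0..s}"
proof (rule conjugate_in_fixing[OF c f])
  note ic = thompson_F_inv_closed[OF c]
  show "(inv\<^bsub>thompson_F\<^esub> c) t \<in> {0..s}" if t: "t \<in> {0..s}" for t
  proof -
    have "(inv\<^bsub>thompson_F\<^esub> c) t \<le> (inv\<^bsub>thompson_F\<^esub> c) (c s)"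
      using t s thompson_F_set_closed[OF c s(1)] by (intro thompson_F_set_mono[OF ic]) auto
    then show ?thesis using thompson_F_inv_apply(1)[OF c s(1)] thompson_F_set_closed[OF ic, of t] t s by auto
  qed
qed (use s in auto)

text \<open>The mirror case: the support moves from [0,s] into [0, c s].\<close>

lemma conjugate_fixing_right:
  assumes c: "c \<in> thompson_F_set" and s: "s \<in> {0..1}" "c s \<le> s" and f: "f \<in> fixing {s..1}"
  shows "c \<otimes>\<^bsub>thompson_F\<^esub> f \<otimes>\<^bsub>thompson_F\<^esub> inv\<^bsub>thompson_F\<^esub> c \<in> fixing {s..1}"
proof (rule conjugate_in_fixing[OF c f])
  note ic = thompson_F_inv_closed[OF c]
  show "(inv\<^bsub>thompson_F\<^esub> c) t \<in> {s..1}" if t: "t \<in> {s..1}" for t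
  proof -
    have "(inv\<^bsub>thompson_F\<^esub> c) (c s) \<le> (inv\<^bsub>thompson_F\<^esub> c) t"
      using t s thompson_F_set_closed[OF c s(1)] by (intro thompson_F_set_mono[OF ic]) auto
    then show ?thesis using thompson_F_inv_apply(1)[OF c s(1)] thompson_F_set_closed[OF ic, of t] t s by auto
  qed
qed (use s in auto)

section \<open>Bumps in small cells and centralizers\<close>

lemma dyadic_cell_between:
  fixes x y :: real
  assumes "0 \<le> x" "x < y" "y \<le> 1"
  obtains m j where "j < 2 ^ m" "x < real j / 2 ^ m" "(real j + 1) / 2 ^ m < y"
proof -
  obtain m where m: "(1/2) ^ m < (y - x) / 2"
    using real_arch_pow_inv[of "(y - x) / 2" "1/2"] assms(2) by auto
  have "x \<in> {0..<1}" using assms by auto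
  then obtain i s where i: "0 \<le> s" "s < 1" "x = (real i + s) / 2 ^ m" by (rule dyadic_cell_cases)
  \<comment> \<open>The cell after the one containing \<open>x\<close>: it begins strictly to the
    right of \<open>x\<close> and ends at most two widths beyond it, and the width is less than half
    the gap.\<close>
  let ?j = "Suc i"
  have "x < real ?j / 2 ^ m" using i by (simp add: divide_strict_right_mono)
  moreover have "(real ?j + 1) / 2 ^ m = x + (2 - s) * (1/2) ^ m"
    using i(3) by (simp add: field_simps power_one_over)
  then have "(real ?j + 1) / 2 ^ m \<le> x + 2 * (1/2) ^ m" using i(1) by simp
  then have y: "(real ?j + 1) / 2 ^ m < y" using m by simp
  moreover have "?j < 2 ^ m"
  proof -
    have "(real ?j + 1) / 2 ^ m < 1" using y assms(3) by linarith
    then have "real (?j + 1) < real (2 ^ m)" by simp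
    then show ?thesis by (simp only: of_nat_less_iff)
  qed
  ultimately show thesis using that by blast
qed

text \<open>
  If \<open>c\<close> moved \<open>x\<close>, some bump in a cell near \<open>x\<close> would be carried off that cell by \<open>c\<close>.
\<close>
lemma commuting_with_bumps_fixes:
  assumes c: "c \<in> thompson_F_set" and x: "x \<in> {0..1}" "l < x" "x < r"
    and comm: "\<And>m j. j < 2 ^ m \<Longrightarrow> l \<le> real j / 2 ^ m \<Longrightarrow> (real j + 1) / 2 ^ m \<le> r \<Longrightarrow>
      insert_cell m j thompson_x0 \<otimes>\<^bsub>thompson_F\<^esub> c = c \<otimes>\<^bsub>thompson_F\<^esub> insert_cell m j thompson_x0"
  shows "c x = x"
proof (rule ccontr)
  assume neq: "c x \<noteq> x"
  note cx = thompson_F_set_closed[OF c x(1)]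
  \<comment> \<open>A cell strictly between \<open>x\<close> and \<open>c x\<close> works: by
    monotonicity its midpoint is moved at least as far as \<open>c x\<close>, hence off the
    cell.\<close>
  have "\<exists>m j. j < 2 ^ m \<and> l \<le> real j / 2 ^ m \<and> (real j + 1) / 2 ^ m \<le> r \<and>
    c ((real j + 1/2) / 2 ^ m) \<notin> {real j / 2 ^ m<..<(real j + 1) / 2 ^ m}"
  proof (cases "x < c x")
    case True
    then have "0 \<le> x" "x < min r (c x)" "min r (c x) \<le> 1" using x cx by auto
    then obtain m j where mj: "j < 2 ^ m" "x < real j / 2 ^ m" "(real j + 1) / 2 ^ m < min r (c x)"
      by (rule dyadic_cell_between)
    have "x \<le> (real j + 1/2) / 2 ^ m" using mj(2) by (simp add: add_divide_distrib add_increasing2)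
    then have "c x \<le> c ((real j + 1/2) / 2 ^ m)"
      using x cell_in_unit[OF mj(1), of "1/2"] by (intro thompson_F_set_mono[OF c]) auto
    then show ?thesis using mj x by (intro exI[of _ m] exI[of _ j]) auto
  next
    case False
    then have "0 \<le> max l (c x)" "max l (c x) < x" "x \<le> 1" using x cx neq by auto
    then obtain m j where mj: "j < 2 ^ m" "max l (c x) < real j / 2 ^ m" "(real j + 1) / 2 ^ m < x"
      by (rule dyadic_cell_between)
    have "(real j + 1/2) / 2 ^ m \<le> (real j + 1) / 2 ^ m" by (simp add: divide_right_mono)
    then have "c ((real j + 1/2) / 2 ^ m) \<le> c x"
      using x mj(3) cell_in_unit[OF mj(1), of "1/2"] by (intro thompson_F_set_mono[OF c]) auto
    then show ?thesis using mj x by (intro exI[of _ m] exI[of _ j]) auto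
  qed
  then obtain m j where j: "j < 2 ^ m" "l \<le> real j / 2 ^ m" "(real j + 1) / 2 ^ m \<le> r"
    "c ((real j + 1/2) / 2 ^ m) \<notin> {real j / 2 ^ m<..<(real j + 1) / 2 ^ m}"
    by blast
  let ?y = "(real j + 1/2) / 2 ^ m" and ?b = "insert_cell m j thompson_x0"
  have y: "?y \<in> {0..1}" using cell_in_unit[OF j(1), of "1/2"] by simp
  have b: "?b \<in> thompson_F_set" by (rule insert_cell_in_thompson_F_set[OF thompson_x0_in_thompson_F_set j(1)])
  \<comment> \<open>The bump fixes points off its cell; by commutation and injectivity of
    \<open>c\<close> it would fix the midpoint, but x0 takes 1/2 to 1/4.\<close>
  have "?b (c ?y) = c ?y"
    using thompson_x0_in_thompson_F_set thompson_F_set_closed[OF c y] j(4)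
    by (intro insert_cell_outside) (auto simp: thompson_F_set_iff)
  then have "c (?b ?y) = c ?y"
    using comm[OF j(1-3)] thompson_F_mult_apply[OF b c y] thompson_F_mult_apply[OF c b y] by simp
  then have "?b ?y = ?y"
    using strict_mono_on_imp_inj_on[OF thompson_F_set_strict_mono[OF c]] y thompson_F_set_closed[OF b y]
    by (auto dest: inj_onD)
  moreover have "?b ?y = (real j + 1/4) / 2 ^ m"
    using insert_cell_inside[OF j(1), of "1/2"] by (simp add: thompson_x0_def)
  ultimately show False by simp
qed

lemma bump_in_fixing:
  assumes "j < 2 ^ m" "T \<subseteq> {0..1}" "T \<inter> {real j / 2 ^ m<..<(real j + 1) / 2 ^ m} = {}"
  shows "insert_cell m j thompson_x0 \<in> fixing T"
proof -
  have "insert_cell m j thompson_x0 t = t" if "t \<in> T" for t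
    using assms that thompson_x0_in_thompson_F_set
    by (intro insert_cell_outside) (auto simp: thompson_F_set_iff)
  then show ?thesis
    using insert_cell_in_thompson_F_set[OF thompson_x0_in_thompson_F_set assms(1)] by (simp add: fixing_def)
qed

text \<open>If \<open>c\<close> moves \<open>x\<close>, take \<open>s\<close> and \<open>y\<close>
  strictly between \<open>x\<close> and \<open>c x\<close>, with \<open>s\<close> separating
  \<open>x\<close> from \<open>y\<close>. As \<open>K\<close> contains all elements supported on one
  side of \<open>s\<close>, \<open>c\<close> fixes all points of that side. So \<open>c\<close>
  fixes \<open>x\<close>, or it fixes \<open>y\<close>, which contradicts monotonicity.\<close>

lemma centralizer_trivial:
  assumes c: "c \<in> thompson_F_set"
    and comm: "\<And>f. f \<in> K \<Longrightarrow> f \<otimes>\<^bsub>thompson_F\<^esub> c = c \<otimes>\<^bsub>thompson_F\<^esub> f"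
    and K: "\<And>s. s \<in> {0..1} \<Longrightarrow> fixing {s..1} \<subseteq> K \<or> fixing {0..s} \<subseteq> K"
  shows "c = \<one>\<^bsub>thompson_F\<^esub>"
proof (rule thompson_F_eqI[OF c])
  show "\<one>\<^bsub>thompson_F\<^esub> \<in> thompson_F_set" using thompson_F.one_closed by (simp add: thompson_F_carrier)
  fix x :: real assume x: "x \<in> {0..1}"
  note cx = thompson_F_set_closed[OF c x]
  \<comment> \<open>The bounds -1 and 2 used here and in the next claim lie outside [0,1], so that 0
    and 1 satisfy the strict inequalities as well.\<close>
  have left: "c y = y" if "s \<in> {0..1}" "fixing {s..1} \<subseteq> K" "y \<in> {0..1}" "y < s" for s y
    by (rule commuting_with_bumps_fixes[OF c that(3), of "-1" s])
      (use that in \<open>auto intro!: comm subsetD[OF that(2)] bump_in_fixing\<close>)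
  have right: "c y = y" if "s \<in> {0..1}" "fixing {0..s} \<subseteq> K" "y \<in> {0..1}" "s < y" for s y
    by (rule commuting_with_bumps_fixes[OF c that(3), of s 2])
      (use that in \<open>auto intro!: comm subsetD[OF that(2)] bump_in_fixing\<close>)
  have "\<not> x < c x"
  proof
    assume less: "x < c x"
    define s y where "s = x + (c x - x) / 3" and "y = x + 2 * (c x - x) / 3"
    have sy: "x < s" "s < y" "y < c x" using less by (auto simp: s_def y_def field_simps)
    then have unit: "s \<in> {0..1}" "y \<in> {0..1}" using x cx by auto
    have "c x \<le> c y" using thompson_F_set_mono[OF c x unit(2)] sy by simp
    then show False using K[OF unit(1)] left[OF unit(1) _ x] right[OF unit(1) _ unit(2)] sy by auto
  qed
  moreover have "\<not> c x < x"
  proof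
    assume less: "c x < x"
    define s y where "s = x - (x - c x) / 3" and "y = x - 2 * (x - c x) / 3"
    have sy: "s < x" "y < s" "c x < y" using less by (auto simp: s_def y_def field_simps)
    then have unit: "s \<in> {0..1}" "y \<in> {0..1}" using x cx by auto
    have "c y \<le> c x" using thompson_F_set_mono[OF c unit(2) x] sy by simp
    then show False using K[OF unit(1)] left[OF unit(1) _ unit(2)] right[OF unit(1) _ x] sy by auto
  qed
  ultimately show "c x = \<one>\<^bsub>thompson_F\<^esub> x" using x by (simp add: thompson_F_one_apply)
qed

section \<open>Words in marked groups\<close>

context group
begin

lemma eval_letter_closed:
  "set S \<subseteq> carrier G \<Longrightarrow> fst l < length S \<Longrightarrow> eval_letter G S l \<in> carrier G"
  by (auto simp: eval_letter_def intro: nth_mem)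

lemma eval_word_Nil: "eval_word G S [] = \<one>"
  by (simp add: eval_word_def)

lemma eval_word_Cons: "eval_word G S (l # w) = eval_letter G S l \<otimes> eval_word G S w"
  by (simp add: eval_word_def)

lemma eval_word_closed:
  "set S \<subseteq> carrier G \<Longrightarrow> fst ` set w \<subseteq> {..<length S} \<Longrightarrow> eval_word G S w \<in> carrier G"
  by (induction w) (auto simp: eval_word_Nil eval_word_Cons eval_letter_closed)

lemma eval_word_append:
  assumes "set S \<subseteq> carrier G" "fst ` set u \<subseteq> {..<length S}" "fst ` set v \<subseteq> {..<length S}"
  shows "eval_word G S (u @ v) = eval_word G S u \<otimes> eval_word G S v"
  using assms(2)
  by (induction u)
    (auto simp: eval_word_Nil eval_word_Cons eval_letter_closed eval_word_closed assms(1,3) m_assoc)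

lemma eval_word_inverse:
  assumes "set S \<subseteq> carrier G" "fst ` set w \<subseteq> {..<length S}"
  shows "eval_word G S (rev (map (\<lambda>(i, e). (i, \<not> e)) w)) = inv (eval_word G S w)"
  using assms(2)
proof (induction w)
  case (Cons l w)
  have letter: "eval_letter G S (fst l, \<not> snd l) = inv (eval_letter G S l)"
    using assms(1) Cons.prems by (auto simp: eval_letter_def intro: nth_mem)
  have sub: "fst ` set (rev (map (\<lambda>(i, e). (i, \<not> e)) w)) \<subseteq> {..<length S}"
    using Cons.prems by (auto simp: case_prod_beta image_subset_iff)
  have "rev (map (\<lambda>(i, e). (i, \<not> e)) (l # w)) = rev (map (\<lambda>(i, e). (i, \<not> e)) w) @ [(fst l, \<not> snd l)]"
    by (cases l) simp
  then have "eval_word G S (rev (map (\<lambda>(i, e). (i, \<not> e)) (l # w))) =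
      inv (eval_word G S w) \<otimes> eval_word G S [(fst l, \<not> snd l)]"
    using Cons by (simp only:) (subst eval_word_append[OF assms(1) sub], auto)
  also have "\<dots> = inv (eval_word G S (l # w))"
    using Cons.prems assms(1)
    by (simp add: letter eval_word_Nil eval_word_Cons eval_letter_closed eval_word_closed inv_mult_group)
  finally show ?case .
qed (simp add: eval_word_Nil)

lemma equal_conjugates_commute:
  assumes "b \<otimes> f \<otimes> inv b = a \<otimes> f \<otimes> inv a" "a \<in> carrier G" "b \<in> carrier G" "f \<in> carrier G"
  shows "f \<otimes> (inv a \<otimes> b) = inv a \<otimes> b \<otimes> f"
proof -
  have "inv a \<otimes> b \<otimes> f = inv a \<otimes> (b \<otimes> f \<otimes> inv b) \<otimes> b" using assms(2-4) by (simp add: m_assoc)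
  also have "\<dots> = f \<otimes> (inv a \<otimes> b)" unfolding assms(1) using assms(2-4) by (simp add: m_assoc[symmetric])
  finally show ?thesis by simp
qed

lemma inv_comm_left:
  assumes "f \<otimes> d = d \<otimes> f" "f \<in> carrier G" "d \<in> carrier G"
  shows "inv f \<otimes> d = d \<otimes> inv f"
proof -
  have "inv f \<otimes> d = inv f \<otimes> (d \<otimes> f) \<otimes> inv f" using assms(2,3) by (simp add: m_assoc)
  also have "\<dots> = d \<otimes> inv f" unfolding assms(1)[symmetric] using assms(2,3) by (simp add: m_assoc[symmetric])
  finally show ?thesis .
qed

end

section \<open>Limits of marked copies of Thompson's group\<close>

locale thompson_limit =
  fixes gs :: "nat \<Rightarrow> real \<Rightarrow> real" and G :: "('a, 'b) monoid_scheme" (structure) and g x0 x1 :: 'a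
  assumes gs: "\<And>n. gs n \<in> carrier thompson_F"
    and marked: "marked_group G [g, x0, x1]"
    and conv: "(\<lambda>n. marked_dist (thompson_F, [gs n, thompson_x0, thompson_x1]) (G, [g, x0, x1])) \<longlonglongrightarrow> 0"

sublocale thompson_limit \<subseteq> group G
  using marked by (simp add: marked_group_def)

context thompson_limit
begin

abbreviation "marks n \<equiv> [gs n, thompson_x0, thompson_x1]"
abbreviation "limit_marks \<equiv> [g, x0, x1]"
abbreviation "base \<equiv> generate G {x0, x1}"

text \<open>One word names both the element of \<open>G\<close> and the sequence in F. The sequence
  is not determined by the element, since different words for it need only agree from some index
  on.\<close>

definition limit_of :: "'a \<Rightarrow> (nat \<Rightarrow> real \<Rightarrow> real) \<Rightarrow> bool" where
  "limit_of x f \<longleftrightarrow> (\<exists>w. fst ` set w \<subseteq> {..<3} \<and> x = eval_word G limit_marks w \<and>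
     (\<forall>n. f n = eval_word thompson_F (marks n) w))"

lemma marks_carrier: "set (marks n) \<subseteq> carrier thompson_F" "set limit_marks \<subseteq> carrier G"
  using gs marked
  by (auto simp: marked_group_def thompson_F_carrier thompson_x0_in_thompson_F_set thompson_x1_in_thompson_F_set)

lemma limit_of_carrier:
  assumes "limit_of x f"
  shows "x \<in> carrier G" "f n \<in> carrier thompson_F"
proof -
  obtain w where "fst ` set w \<subseteq> {..<length limit_marks}" "fst ` set w \<subseteq> {..<length (marks n)}"
    "x = eval_word G limit_marks w" "f n = eval_word thompson_F (marks n) w"
    using assms unfolding limit_of_def by (auto simp: eval_nat_numeral)
  then show "x \<in> carrier G" "f n \<in> carrier thompson_F"
    using eval_word_closed thompson_F.eval_word_closed marks_carrier by metis+
qed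

lemma limit_of_one: "limit_of \<one> (\<lambda>_. \<one>\<^bsub>thompson_F\<^esub>)"
  unfolding limit_of_def by (rule exI[of _ "[]"]) (simp add: eval_word_Nil thompson_F.eval_word_Nil)

lemma limit_of_mult:
  assumes "limit_of x f" "limit_of y h"
  shows "limit_of (x \<otimes> y) (\<lambda>n. f n \<otimes>\<^bsub>thompson_F\<^esub> h n)"
proof -
  obtain u v where u: "fst ` set u \<subseteq> {..<3}" "x = eval_word G limit_marks u"
      "\<And>n. f n = eval_word thompson_F (marks n) u"
    and v: "fst ` set v \<subseteq> {..<3}" "y = eval_word G limit_marks v"
      "\<And>n. h n = eval_word thompson_F (marks n) v"
    using assms unfolding limit_of_def by blast
  have "eval_word G limit_marks (u @ v) = x \<otimes> y"
    unfolding u(2) v(2) by (rule eval_word_append[OF marks_carrier(2)]) (use u(1) v(1) in \<open>simp_all add: eval_nat_numeral\<close>)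
  moreover have "eval_word thompson_F (marks n) (u @ v) = f n \<otimes>\<^bsub>thompson_F\<^esub> h n" for n
    unfolding u(3) v(3) by (rule thompson_F.eval_word_append[OF marks_carrier(1)]) (use u(1) v(1) in \<open>simp_all add: eval_nat_numeral\<close>)
  moreover have "fst ` set (u @ v) \<subseteq> {..<3}" using u(1) v(1) by (simp add: image_Un)
  ultimately show ?thesis unfolding limit_of_def by metis
qed

lemma limit_of_inv:
  assumes "limit_of x f"
  shows "limit_of (inv x) (\<lambda>n. inv\<^bsub>thompson_F\<^esub> f n)"
proof -
  obtain u where u: "fst ` set u \<subseteq> {..<3}" "x = eval_word G limit_marks u"
      "\<And>n. f n = eval_word thompson_F (marks n) u"
    using assms unfolding limit_of_def by blast
  let ?v = "rev (map (\<lambda>(i, e). (i, \<not> e)) u)"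
  have "eval_word G limit_marks ?v = inv x"
    unfolding u(2) by (rule eval_word_inverse[OF marks_carrier(2)]) (use u(1) in \<open>simp add: eval_nat_numeral\<close>)
  moreover have "eval_word thompson_F (marks n) ?v = inv\<^bsub>thompson_F\<^esub> f n" for n
    unfolding u(3) by (rule thompson_F.eval_word_inverse[OF marks_carrier(1)]) (use u(1) in \<open>simp add: eval_nat_numeral\<close>)
  moreover have "fst ` set ?v \<subseteq> {..<3}" using u(1) by (auto simp: case_prod_beta image_subset_iff)
  ultimately show ?thesis unfolding limit_of_def by metis
qed

lemma limit_of_generators:
  "limit_of g gs" "limit_of x0 (\<lambda>_. thompson_x0)" "limit_of x1 (\<lambda>_. thompson_x1)"
proof -
  have gen: "limit_of (limit_marks ! i) (\<lambda>n. marks n ! i)" if "i < 3" for i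
  proof -
    have "limit_marks ! i \<in> carrier G" "marks n ! i \<in> carrier thompson_F" for n
      using that marks_carrier(2) marks_carrier(1)[of n]
      by (auto simp: subset_iff intro!: nth_mem simp del: nth_Cons_Suc set_simps list.set)
    then show ?thesis
      unfolding limit_of_def using that
      by (intro exI[of _ "[(i, True)]"])
        (simp add: eval_word_Cons thompson_F.eval_word_Cons eval_word_Nil thompson_F.eval_word_Nil eval_letter_def)
  qed
  show "limit_of g gs" "limit_of x0 (\<lambda>_. thompson_x0)" "limit_of x1 (\<lambda>_. thompson_x1)"
    using gen[of 0] gen[of 1] gen[of 2] by simp_all
qed

text \<open>Once the distance is below exp(-R), R the length of \<open>w\<close>, the two markings
  have the same relations up to length R, and \<open>w\<close> is within this range.\<close>

lemma eventually_same_relation: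
  assumes "fst ` set w \<subseteq> {..<3}"
  shows "\<forall>\<^sub>F n in sequentially.
    eval_word thompson_F (marks n) w = \<one>\<^bsub>thompson_F\<^esub> \<longleftrightarrow> eval_word G limit_marks w = \<one>"
proof -
  have "\<forall>\<^sub>F n in sequentially. marked_dist (thompson_F, marks n) (G, limit_marks) < exp (- real (length w))"
    using order_tendstoD(2)[OF conv] by simp
  then show ?thesis
  proof eventually_elim
    case (elim n)
    then have "relations_upto thompson_F (marks n) (length w) = relations_upto G limit_marks (length w)"
      using marked_dist_le_iff[of "marks n" limit_marks thompson_F G "length w"] by simp
    then have "w \<in> relations_upto thompson_F (marks n) (length w) \<longleftrightarrow> w \<in> relations_upto G limit_marks (length w)"
      by simp
    moreover have "fst ` set w \<subseteq> {..<length (marks n)}" using assms by (simp add: eval_nat_numeral)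
    ultimately show ?case unfolding relations_upto_def by simp
  qed
qed

lemma limit_of_eq:
  assumes "limit_of x f" "limit_of y h"
  shows "\<forall>\<^sub>F n in sequentially. f n = h n \<longleftrightarrow> x = y"
proof -
  have "limit_of (x \<otimes> inv y) (\<lambda>n. f n \<otimes>\<^bsub>thompson_F\<^esub> inv\<^bsub>thompson_F\<^esub> h n)"
    using assms by (intro limit_of_mult limit_of_inv)
  then obtain w where w: "fst ` set w \<subseteq> {..<3}" "x \<otimes> inv y = eval_word G limit_marks w"
      "\<And>n. f n \<otimes>\<^bsub>thompson_F\<^esub> inv\<^bsub>thompson_F\<^esub> h n = eval_word thompson_F (marks n) w"
    unfolding limit_of_def by blast
  from eventually_same_relation[OF w(1)] show ?thesis
  proof eventually_elim
    case (elim n)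
    have "x = y \<longleftrightarrow> x \<otimes> inv y = \<one>"
      using limit_of_carrier(1)[OF assms(1)] limit_of_carrier(1)[OF assms(2)] inv_solve_right[of \<one> x y] by auto
    moreover have "f n = h n \<longleftrightarrow> f n \<otimes>\<^bsub>thompson_F\<^esub> inv\<^bsub>thompson_F\<^esub> h n = \<one>\<^bsub>thompson_F\<^esub>"
      using limit_of_carrier(2)[OF assms(1), of n] limit_of_carrier(2)[OF assms(2), of n]
        thompson_F.inv_solve_right[of "\<one>\<^bsub>thompson_F\<^esub>" "f n" "h n"] by auto
    ultimately show ?case using elim w by simp
  qed
qed

text \<open>Equality infinitely often is enough: for two given sequences the answer is eventually
  constant and agrees with the answer in \<open>G\<close>.\<close>

lemma limit_of_eqI:
  assumes "limit_of x f" "limit_of y h" "\<exists>\<^sub>F n in sequentially. f n = h n"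
  shows "x = y"
proof (rule ccontr)
  assume "x \<noteq> y"
  then have "\<forall>\<^sub>F n in sequentially. \<not> f n = h n" using limit_of_eq[OF assms(1,2)] by simp
  then show False using assms(3) by (simp add: frequently_def)
qed

section \<open>Identification of the base with F\<close>

lemma base_subgroup: "subgroup base G"
  using marked by (intro generate_is_subgroup) (simp add: marked_group_def)

text \<open>Constant sequences that agree eventually are equal. Together with the next two lemmas
  this matches elements of \<open>base\<close> with elements of F.\<close>

lemma limit_of_const_unique: "limit_of x (\<lambda>_. f) \<Longrightarrow> limit_of x (\<lambda>_. h) \<Longrightarrow> f = h"
  using limit_of_eq[of x "\<lambda>_. f" x "\<lambda>_. h"] by simp

lemma base_limit_of_const: "a \<in> base \<Longrightarrow> \<exists>f. limit_of a (\<lambda>_. f)"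
proof (induction rule: generate.induct)
  case one
  show ?case using limit_of_one by blast
next
  case (incl h)
  then show ?case using limit_of_generators by blast
next
  case (inv h)
  then show ?case using limit_of_inv[OF limit_of_generators(2)] limit_of_inv[OF limit_of_generators(3)] by blast
next
  case (eng h1 h2)
  then show ?case using limit_of_mult by fast
qed

text \<open>Generation of F by x0 and x1 enters here: every element of F, in particular each single
  \<open>gs N\<close>, has a counterpart in the base.\<close>

lemma const_limit_of_base:
  assumes "f \<in> carrier thompson_F"
  shows "\<exists>a\<in>base. limit_of a (\<lambda>_. f)"
proof -
  have "f \<in> generate thompson_F {thompson_x0, thompson_x1}" using assms thompson_F_generated by simp
  then show ?thesis
  proof (induction rule: generate.induct)
    case one
    show ?case using limit_of_one generate.one by blast
  next
    case (incl h)
    then show ?case using limit_of_generators generate.incl[of _ "{x0, x1}" G] by blast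
  next
    case (inv h)
    then show ?case
      using limit_of_inv[OF limit_of_generators(2)] limit_of_inv[OF limit_of_generators(3)]
        generate.inv[of _ "{x0, x1}" G] by blast
  next
    case (eng h1 h2)
    then obtain a1 a2 where "a1 \<in> base" "limit_of a1 (\<lambda>_. h1)" "a2 \<in> base" "limit_of a2 (\<lambda>_. h2)" by blast
    then show ?case using limit_of_mult[of a1 "\<lambda>_. h1" a2 "\<lambda>_. h2"] generate.eng[of a1 G "{x0, x1}" a2] by blast
  qed
qed

section \<open>The contradiction from an HNN structure on the limit\<close>

lemma not_hnn_extension:
  assumes fg: "finitely_generated_subgroup H (G\<lparr>carrier := base\<rparr>)"
    and hnn: "is_hnn_extension G base H \<alpha> g"
  shows False
proof -
  note F = thompson_F_carrier
  have subH: "subgroup H (G\<lparr>carrier := base\<rparr>)" using fg by (simp add: finitely_generated_subgroup_def)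
  have Hbase: "H \<subseteq> base" using subgroup.subset[OF subH] by simp
  have H: "subgroup H G" using incl_subgroup[OF base_subgroup subH] .
  obtain S where S: "finite S" "S \<subseteq> H" "generate G S = H"
  proof -
    obtain S where S: "finite S" "S \<subseteq> H" "generate (G\<lparr>carrier := base\<rparr>) S = H"
      using fg unfolding finitely_generated_subgroup_def by blast
    moreover have "generate (G\<lparr>carrier := base\<rparr>) S = generate G S"
      using S(2) Hbase by (intro generate_consistent[OF _ base_subgroup]) auto
    ultimately show thesis using that by simp
  qed
  have g: "g \<in> carrier G" using marks_carrier(2) by simp
  have \<alpha>base: "\<alpha> h \<in> base" if "h \<in> H" for h
    using hnn that by (auto simp: is_hnn_extension_def mon_def hom_def)
  have conj: "g \<otimes> h \<otimes> inv g = \<alpha> h" if "h \<in> H" for h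
    using hnn_extension_conjugation[OF is_group hnn that] .
  have "\<forall>\<^sub>F n in sequentially. \<forall>h\<in>S. \<forall>f f'. limit_of h (\<lambda>_. f) \<longrightarrow> limit_of (\<alpha> h) (\<lambda>_. f') \<longrightarrow>
      gs n \<otimes>\<^bsub>thompson_F\<^esub> f \<otimes>\<^bsub>thompson_F\<^esub> inv\<^bsub>thompson_F\<^esub> gs n = f'"
  \<comment> \<open>Finite generation of \<open>H\<close> is used here: finitely many conjugation
    relations hold simultaneously from some index on.\<close>
  proof (rule eventually_ball_finite[OF S(1)], intro ballI)
    fix h assume "h \<in> S"
    then have h: "h \<in> H" using S(2) by blast
    obtain f f' where f: "limit_of h (\<lambda>_. f)" "limit_of (\<alpha> h) (\<lambda>_. f')"
      using base_limit_of_const h \<alpha>base Hbase by blast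
    have "limit_of (g \<otimes> h \<otimes> inv g) (\<lambda>n. gs n \<otimes>\<^bsub>thompson_F\<^esub> f \<otimes>\<^bsub>thompson_F\<^esub> inv\<^bsub>thompson_F\<^esub> gs n)"
      using f limit_of_generators(1) by (intro limit_of_mult limit_of_inv)
    from limit_of_eq[OF this f(2)]
    show "\<forall>\<^sub>F n in sequentially. \<forall>f f'. limit_of h (\<lambda>_. f) \<longrightarrow> limit_of (\<alpha> h) (\<lambda>_. f') \<longrightarrow>
      gs n \<otimes>\<^bsub>thompson_F\<^esub> f \<otimes>\<^bsub>thompson_F\<^esub> inv\<^bsub>thompson_F\<^esub> gs n = f'"
    proof eventually_elim
      case (elim n)
      then show ?case
        using conj[OF h] limit_of_const_unique[OF f(1)] limit_of_const_unique[OF f(2)] by blast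
    qed
  qed
  then obtain N where N: "\<And>n h f f'. n \<ge> N \<Longrightarrow> h \<in> S \<Longrightarrow> limit_of h (\<lambda>_. f) \<Longrightarrow> limit_of (\<alpha> h) (\<lambda>_. f') \<Longrightarrow>
      gs n \<otimes>\<^bsub>thompson_F\<^esub> f \<otimes>\<^bsub>thompson_F\<^esub> inv\<^bsub>thompson_F\<^esub> gs n = f'"
    unfolding eventually_sequentially by blast
  \<comment> \<open>A single late term, viewed in the base, is the conjugator: all later terms act
    in the same way on the generators of \<open>H\<close>.\<close>
  obtain c where c: "c \<in> base" "limit_of c (\<lambda>_. gs N)" using const_limit_of_base[OF gs] by blast
  define t where "t = inv c \<otimes> g"
  define d where "d = (\<lambda>n. inv\<^bsub>thompson_F\<^esub> gs N \<otimes>\<^bsub>thompson_F\<^esub> gs n)"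
  have td: "limit_of t d" unfolding t_def d_def using c limit_of_generators(1) by (intro limit_of_mult limit_of_inv)
  have d: "d n \<in> carrier thompson_F" for n using gs by (simp add: d_def)
  have cc: "c \<in> carrier G" using limit_of_carrier(1)[OF c(2)] .
  have tc: "t \<in> carrier G" using limit_of_carrier(1)[OF td] .
  have gct: "g = c \<otimes> t" using cc g by (simp add: t_def m_assoc[symmetric])
  \<comment> \<open>Two elements conjugating \<open>f\<close> to the same result differ by an
    element commuting with \<open>f\<close>; induction over \<open>generate\<close> passes from
    \<open>S\<close> to all of \<open>H\<close>.\<close>
  have comm: "f \<otimes>\<^bsub>thompson_F\<^esub> d n = d n \<otimes>\<^bsub>thompson_F\<^esub> f"
    if n: "n \<ge> N" and "h \<in> H" "limit_of h (\<lambda>_. f)" for n h f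
  proof -
    have "h \<in> generate G S" using that S by simp
    then have "\<exists>f. limit_of h (\<lambda>_. f) \<and> f \<otimes>\<^bsub>thompson_F\<^esub> d n = d n \<otimes>\<^bsub>thompson_F\<^esub> f"
    proof (induction rule: generate.induct)
      case one
      show ?case using limit_of_one d by (intro exI[of _ "\<one>\<^bsub>thompson_F\<^esub>"]) simp
    next
      case (incl h)
      then have h: "h \<in> H" using S(2) by blast
      then obtain f f' where f: "limit_of h (\<lambda>_. f)" "limit_of (\<alpha> h) (\<lambda>_. f')"
        using base_limit_of_const \<alpha>base Hbase by blast
      have "gs n \<otimes>\<^bsub>thompson_F\<^esub> f \<otimes>\<^bsub>thompson_F\<^esub> inv\<^bsub>thompson_F\<^esub> gs n =
          gs N \<otimes>\<^bsub>thompson_F\<^esub> f \<otimes>\<^bsub>thompson_F\<^esub> inv\<^bsub>thompson_F\<^esub> gs N"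
        using N[OF n incl f] N[OF order_refl incl f] by simp
      then have "f \<otimes>\<^bsub>thompson_F\<^esub> d n = d n \<otimes>\<^bsub>thompson_F\<^esub> f"
        unfolding d_def by (rule thompson_F.equal_conjugates_commute) (use gs limit_of_carrier(2)[OF f(1)] in auto)
      then show ?case using f(1) by blast
    next
      case (inv h)
      then have h: "h \<in> H" using S(2) by blast
      then obtain f f' where f: "limit_of h (\<lambda>_. f)" "limit_of (\<alpha> h) (\<lambda>_. f')"
        using base_limit_of_const \<alpha>base Hbase by blast
      have fc: "f \<in> carrier thompson_F" using limit_of_carrier(2)[OF f(1)] .
      have "gs n \<otimes>\<^bsub>thompson_F\<^esub> f \<otimes>\<^bsub>thompson_F\<^esub> inv\<^bsub>thompson_F\<^esub> gs n =
          gs N \<otimes>\<^bsub>thompson_F\<^esub> f \<otimes>\<^bsub>thompson_F\<^esub> inv\<^bsub>thompson_F\<^esub> gs N"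
        using N[OF n inv f] N[OF order_refl inv f] by simp
      then have "f \<otimes>\<^bsub>thompson_F\<^esub> d n = d n \<otimes>\<^bsub>thompson_F\<^esub> f"
        unfolding d_def by (rule thompson_F.equal_conjugates_commute) (use gs fc in auto)
      then have "inv\<^bsub>thompson_F\<^esub> f \<otimes>\<^bsub>thompson_F\<^esub> d n = d n \<otimes>\<^bsub>thompson_F\<^esub> inv\<^bsub>thompson_F\<^esub> f"
        using fc d by (metis thompson_F.inv_comm_left)
      then show ?case using limit_of_inv[OF f(1)] by blast
    next
      case (eng h1 h2)
      then obtain f1 f2 where f: "limit_of h1 (\<lambda>_. f1)" "limit_of h2 (\<lambda>_. f2)"
        "f1 \<otimes>\<^bsub>thompson_F\<^esub> d n = d n \<otimes>\<^bsub>thompson_F\<^esub> f1" "f2 \<otimes>\<^bsub>thompson_F\<^esub> d n = d n \<otimes>\<^bsub>thompson_F\<^esub> f2"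
        by blast
      have fc: "f1 \<in> carrier thompson_F" "f2 \<in> carrier thompson_F"
        using limit_of_carrier(2)[OF f(1)] limit_of_carrier(2)[OF f(2)] by auto
      have "f1 \<otimes>\<^bsub>thompson_F\<^esub> f2 \<otimes>\<^bsub>thompson_F\<^esub> d n = f1 \<otimes>\<^bsub>thompson_F\<^esub> d n \<otimes>\<^bsub>thompson_F\<^esub> f2"
        using fc d f(4) by (simp add: thompson_F.m_assoc)
      then have "f1 \<otimes>\<^bsub>thompson_F\<^esub> f2 \<otimes>\<^bsub>thompson_F\<^esub> d n = d n \<otimes>\<^bsub>thompson_F\<^esub> (f1 \<otimes>\<^bsub>thompson_F\<^esub> f2)"
        using fc d f(3) by (simp add: thompson_F.m_assoc)
      then show ?case using limit_of_mult[OF f(1,2)] by blast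
    qed
    then show ?thesis using limit_of_const_unique that by blast
  qed
  \<comment> \<open>In the limit \<open>t\<close> commutes with \<open>H\<close>, so on
    \<open>H\<close> conjugation by \<open>g\<close>, which is \<open>c\<close> times
    \<open>t\<close>, is conjugation by \<open>c\<close>. This brings the action on levels into
    play.\<close>
  have \<alpha>: "\<alpha> h = c \<otimes> h \<otimes> inv c" if h: "h \<in> H" for h
  proof -
    obtain f where f: "limit_of h (\<lambda>_. f)" using base_limit_of_const h Hbase by blast
    have ht: "h \<otimes> t = t \<otimes> h"
    proof (rule limit_of_eqI[OF limit_of_mult[OF f td] limit_of_mult[OF td f]])
      show "\<exists>\<^sub>F n in sequentially. f \<otimes>\<^bsub>thompson_F\<^esub> d n = d n \<otimes>\<^bsub>thompson_F\<^esub> f"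
        using comm[OF _ h f] by (intro eventually_frequently) (auto simp: eventually_sequentially)
    qed
    have hc: "h \<in> carrier G" using subgroup.mem_carrier[OF H h] .
    have "t \<otimes> h \<otimes> inv t = h" unfolding ht[symmetric] using tc hc by (simp add: m_assoc)
    moreover have "g \<otimes> h \<otimes> inv g = c \<otimes> (t \<otimes> h \<otimes> inv t) \<otimes> inv c"
      unfolding gct using cc tc hc by (simp add: inv_mult_group m_assoc)
    ultimately show ?thesis using conj[OF h] by simp
  qed
  \<comment> \<open>The copy of \<open>H\<close> inside F.\<close>
  define K where "K = {f \<in> thompson_F_set. \<exists>h\<in>H. limit_of h (\<lambda>_. f)}"
  have dich: "fixing {s..1} \<subseteq> K \<or> fixing {0..s} \<subseteq> K" if s: "s \<in> {0..1}" for s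
  proof (rule ccontr)
    assume "\<not> ?thesis"
    then obtain a b where ab: "a \<in> fixing {s..1}" "a \<notin> K" "b \<in> fixing {0..s}" "b \<notin> K" by blast
    then have abF: "a \<in> thompson_F_set" "b \<in> thompson_F_set" by (auto simp: fixing_def)
    obtain a' where a': "a' \<in> base" "limit_of a' (\<lambda>_. a)" using const_limit_of_base abF F by metis
    obtain b' where b': "b' \<in> base" "limit_of b' (\<lambda>_. b)" using const_limit_of_base abF F by metis
    have notH: "a' \<notin> H" "b' \<notin> H" using ab a' b' abF by (auto simp: K_def)
    \<comment> \<open>Stated for general \<open>u\<close> and \<open>v\<close>, because
      \<open>a\<close> and \<open>b\<close> exchange roles according to the direction in which
      \<open>d n\<close> moves \<open>s\<close>.\<close>
    have contra: False
      if "\<exists>\<^sub>F n in sequentially. u \<otimes>\<^bsub>thompson_F\<^esub> (d n \<otimes>\<^bsub>thompson_F\<^esub> v \<otimes>\<^bsub>thompson_F\<^esub> inv\<^bsub>thompson_F\<^esub> d n)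
          = d n \<otimes>\<^bsub>thompson_F\<^esub> v \<otimes>\<^bsub>thompson_F\<^esub> inv\<^bsub>thompson_F\<^esub> d n \<otimes>\<^bsub>thompson_F\<^esub> u"
        and u: "u' \<in> base" "limit_of u' (\<lambda>_. u)" "u' \<notin> H" and v: "v' \<in> base" "limit_of v' (\<lambda>_. v)" "v' \<notin> H"
      for u v u' v'
    proof -
      have k: "limit_of (t \<otimes> v' \<otimes> inv t) (\<lambda>n. d n \<otimes>\<^bsub>thompson_F\<^esub> v \<otimes>\<^bsub>thompson_F\<^esub> inv\<^bsub>thompson_F\<^esub> d n)"
        using td v(2) by (intro limit_of_mult limit_of_inv)
      have "u' \<otimes> (t \<otimes> v' \<otimes> inv t) = t \<otimes> v' \<otimes> inv t \<otimes> u'"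
        by (rule limit_of_eqI[OF limit_of_mult[OF u(2) k] limit_of_mult[OF k u(2)] that(1)])
      then show False
        using commuting_conjugate_in_associated[OF is_group hnn c(1) \<alpha> u(1) v(1)] u(3) v(3) by (simp add: t_def)
    qed
    have dF: "d n \<in> thompson_F_set" for n using d F by simp
    show False
    proof (cases "\<exists>\<^sub>F n in sequentially. s \<le> d n s")
      case True
      show False
      proof (rule contra[OF _ a' notH(1) b' notH(2)])
        show "\<exists>\<^sub>F n in sequentially. a \<otimes>\<^bsub>thompson_F\<^esub> (d n \<otimes>\<^bsub>thompson_F\<^esub> b \<otimes>\<^bsub>thompson_F\<^esub> inv\<^bsub>thompson_F\<^esub> d n)
            = d n \<otimes>\<^bsub>thompson_F\<^esub> b \<otimes>\<^bsub>thompson_F\<^esub> inv\<^bsub>thompson_F\<^esub> d n \<otimes>\<^bsub>thompson_F\<^esub> a"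
          using True
          by (rule frequently_elim1)
            (rule fixing_left_right_commute[OF s ab(1) conjugate_fixing_left[OF dF s _ ab(3)]])
      qed
    next
      case False
      then have "\<forall>\<^sub>F n in sequentially. d n s \<le> s" by (auto simp: not_frequently elim: eventually_mono)
      then have "\<exists>\<^sub>F n in sequentially. d n s \<le> s" by (intro eventually_frequently) auto
      then have "\<exists>\<^sub>F n in sequentially. b \<otimes>\<^bsub>thompson_F\<^esub> (d n \<otimes>\<^bsub>thompson_F\<^esub> a \<otimes>\<^bsub>thompson_F\<^esub> inv\<^bsub>thompson_F\<^esub> d n)
            = d n \<otimes>\<^bsub>thompson_F\<^esub> a \<otimes>\<^bsub>thompson_F\<^esub> inv\<^bsub>thompson_F\<^esub> d n \<otimes>\<^bsub>thompson_F\<^esub> b"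
        by (rule frequently_elim1)
          (rule fixing_left_right_commute[OF s conjugate_fixing_right[OF dF s _ ab(1)] ab(3), symmetric])
      then show False by (rule contra[OF _ b' notH(2) a' notH(1)])
    qed
  qed
  have "d n = \<one>\<^bsub>thompson_F\<^esub>" if "n \<ge> N" for n
    by (rule centralizer_trivial[of _ K]) (use d dich comm[OF that] in \<open>auto simp: F K_def\<close>)
  then have "\<exists>\<^sub>F n in sequentially. d n = \<one>\<^bsub>thompson_F\<^esub>"
    by (intro eventually_frequently) (auto simp: eventually_sequentially)
  then have "t = \<one>" by (rule limit_of_eqI[OF td limit_of_one])
  then have "g = c" using gct cc by simp
  then show False using stable_letter_notin_base[OF is_group hnn c(1) \<alpha>] c(1) by simp
qed

end

theorem theorem4p7:
  fixes gs :: "nat \<Rightarrow> real \<Rightarrow> real"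
    and G :: "('a, 'b) monoid_scheme" and g x0 x1 :: 'a
  assumes "\<And>n. gs n \<in> carrier thompson_F"
    and "marked_group G [g, x0, x1]"
    and "(\<lambda>n. marked_dist (thompson_F, [gs n, thompson_x0, thompson_x1]) (G, [g, x0, x1]))
           \<longlonglongrightarrow> 0"
  shows "\<not> (\<exists>H \<alpha>.
           finitely_generated_subgroup H (G\<lparr>carrier := generate G {x0, x1}\<rparr>) \<and>
           \<alpha> \<in> mon (G\<lparr>carrier := H\<rparr>) (G\<lparr>carrier := generate G {x0, x1}\<rparr>) \<and>
           is_hnn_extension G (generate G {x0, x1}) H \<alpha> g)"
proof -
  interpret thompson_limit gs G g x0 x1 by unfold_locales (use assms in auto)
  show ?thesis using not_hnn_extension by blast
qed

end
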